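(* Let $\mathcal{G}$ be a strongly-connected directed graph on $n\ge 2$ agents with a compatible row-stochastic weight matrix $A$, and let $f_1,\dots,f_n:\mathbb{R}\to\mathbb{R}$ be differentiable, strongly convex with constant $s>0$, and with $l$-Lipschitz gradients. Let $x^*$ be the unique minimizer of $f=\sum_{i=1}^n f_i$ and $\mathbf{x}^*=x^*\mathbf{1}_n$. Let $\sigma,c,d,\tau,\epsilon,\widetilde{y},\gamma_1$ and $G$ be as defined in the context, and let $$\overline{\alpha}=\min\left\{\frac{\sqrt{\Delta^2+4cd\epsilon\widetilde{y}n^3l^2(l+s)s(1-\sigma)^2}-\Delta}{2cd\epsilon\widetilde{y}n^2l^2(l+s)},\ \frac{1}{nl}\right\},\qquad \Delta=cd\epsilon\widetilde{y}lns(\tau+1-\sigma).$$ Suppose the step-size satisfies $\alpha\in(0,\overline{\alpha})$, and let $\{\mathbf{x}_k\}_{k\ge 0}$ be generated, from an arbitrary $\mathbf{x}_0\in\mathbb{R}^n$, by the algorithm $$\mathbf{x}_{k+1}=A\mathbf{x}_k-\alpha\mathbf{z}_k,\qquad Y_{k+1}=AY_k,\qquad \mathbf{z}_{k+1}=A\mathbf{z}_k+\widetilde{Y}_{k+1}^{-1}\nabla\mathbf{f}_{k+1}-\widetilde{Y}_k^{-1}\nabla\mathbf{f}_k,$$ with $Y_0=I_n$ and $\mathbf{z}_0=\nabla\mathbf{f}_0$. Then $\{\mathbf{x}_k\}$ converges linearly to $\mathbf{x}^*$ in the following sense: there exist $\gamma_2\in(0,1)$ and $0<\Gamma_2<\infty$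 with $\|G^k\|_2\le\Gamma_2\gamma_2^k$ for all $k\ge0$, and for any such $\gamma_2$, setting $\gamma=\max\{\gamma_1,\gamma_2\}<1$, for every (arbitrarily small) constant $\xi>0$ there exists a constant $M>0$ such that $$\|\mathbf{x}_k-\mathbf{x}^*\|_2\le M(\gamma+\xi)^k\qquad\text{for all }k\ge 0.$$
   Context: Graph and weights: $\mathcal{G}=(\mathcal{V},\mathcal{E})$ with $\mathcal{V}=\{1,\dots,n\}$ is a strongly-connected directed graph; $(i,j)\in\mathcal{E}$ means agent $j$ can send information to agent $i$. $\mathcal{N}_i^{\rm in}$ consists of agent $i$ itself together with all agents that can send information to $i$. The weight matrix $A=\{a_{ij}\}\in\mathbb{R}^{n\times n}$ satisfies $a_{ij}>0$ if $j\in\mathcal{N}_i^{\rm in}$, $a_{ij}=0$ otherwise, and $\sum_{j=1}^n a_{ij}=1$ for every $i$ (row-stochastic). Functions (decision variable of dimension one): each $f_i:\mathbb{R}\to\mathbb{R}$ is differentiable, and for all $x_1,x_2$: $f_i(x_1)-f_i(x_2)\le\nabla f_i(x_1)(x_1-x_2)-\frac{s}{2}|x_1-x_2|^2$ with $s>0$, and $|\nabla f_i(x_1)-\nabla f_i(x_2)|\le l|x_1-x_2|$ with $l>0$. Notation: $\mathbf{1}_n$ is the all-ones vector, $I_n$ the identity. $\mathbf{x}_k=[x_{k,1},\dots,x_{k,n}]^\top$, $\nabla\mathbf{f}_k=[\nabla f_1(x_{k,1}),\dots,\nabla f_n(x_{k,n})]^\top$. $Y_k=A^k$ and $\widetilde{Y}_k=\mathrm{diag}(Y_k)$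 is the diagonal matrix with the same diagonal entries as $Y_k$ (it is invertible for every $k$). $Y_\infty=\lim_{k\to\infty}A^k$. $\|\cdot\|_2$ is the Euclidean norm for vectors and the induced norm for matrices. Constants: $\tau=\|A-I_n\|_2$, $\epsilon=\|I_n-Y_\infty\|_2$, $\widetilde{y}=\sup_k\|\widetilde{Y}_k^{-1}\|_2<\infty$, $\eta=\max(|1-\alpha nl|,|1-\alpha ns|)$. $\gamma_1\in(0,1)$ and $T\in(0,\infty)$ are fixed constants with $\|Y_k-Y_\infty\|_2\le T\gamma_1^k$ for all $k$. $\|\cdot\|$ is a fixed vector norm on $\mathbb{R}^n$ and $\sigma\in(0,1)$ a fixed constant such that $\|A\mathbf{a}-Y_\infty\mathbf{a}\|\le\sigma\|\mathbf{a}-Y_\infty\mathbf{a}\|$ for all $\mathbf{a}\in\mathbb{R}^n$ (such a norm and constant exist). $c,d>0$ are norm-equivalence constants: $\|\mathbf{a}\|_2\le c\|\mathbf{a}\|$ and $\|\mathbf{a}\|\le d\|\mathbf{a}\|_2$ for all $\mathbf{a}\in\mathbb{R}^n$. The $3\times3$ matrix $G$ is $$G=\begin{bmatrix}\sigma&0&\alpha\\ \alpha cnl&\eta&0\\ cd\epsilon\widetilde{y}l(\tau+\alpha nl)&\alpha d\epsilon l^2\widetilde{y}n&\sigma+\alpha cd\epsilon l\widetilde{y}\end{bmatrix}.$$ *)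

theory Defs
  imports "HOL-Analysis.Analysis"
begin

text \<open>On \<^typ>\<open>real ^ 'n ^ 'n\<close> the operators \<open>*\<close> and \<open>^\<close> are componentwise, so matrix powers are
  defined here from the matrix product \<open>**\<close>.\<close>

primrec matpow :: "real ^ 'n ^ 'n \<Rightarrow> nat \<Rightarrow> real ^ 'n ^ 'n" where
  "matpow A 0 = mat 1"
| "matpow A (Suc k) = A ** matpow A k"

definition diag_part :: "real ^ 'n ^ 'n \<Rightarrow> real ^ 'n ^ 'n" where
  "diag_part B = (\<chi> i j. if i = j then B $ i $ i else 0)"

text \<open>\<^const>\<open>norm\<close> on \<^typ>\<open>real ^ 'n ^ 'n\<close> is the Frobenius norm; the induced 2-norm is
  the operator norm of the associated linear map.\<close>

definition mat_norm2 :: "real ^ 'n ^ 'm \<Rightarrow> real" where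
  "mat_norm2 B = onorm (\<lambda>v. B *v v)"

text \<open>An edge \<open>(i, j)\<close> means that agent \<open>j\<close> can send information to agent \<open>i\<close>.
  The vertex set is the whole index type.\<close>

definition strongly_connected :: "('n \<times> 'n) set \<Rightarrow> bool" where
  "strongly_connected E \<longleftrightarrow> (\<forall>i j. (i, j) \<in> E\<^sup>*)"

definition in_neighbours :: "('n \<times> 'n) set \<Rightarrow> 'n \<Rightarrow> 'n set" where
  "in_neighbours E i = insert i {j. (i, j) \<in> E}"

definition row_stochastic_weights :: "('n::finite \<times> 'n) set \<Rightarrow> real ^ 'n ^ 'n \<Rightarrow> bool" where
  "row_stochastic_weights E A \<longleftrightarrow>
     (\<forall>i j. j \<in> in_neighbours E i \<longrightarrow> A $ i $ j > 0) \<and>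
     (\<forall>i j. j \<notin> in_neighbours E i \<longrightarrow> A $ i $ j = 0) \<and>
     (\<forall>i. (\<Sum>j\<in>UNIV. A $ i $ j) = 1)"

definition strongly_convex :: "real \<Rightarrow> (real \<Rightarrow> real) \<Rightarrow> bool" where
  "strongly_convex s g \<longleftrightarrow>
     (\<forall>x1 x2. g x1 - g x2 \<le> deriv g x1 * (x1 - x2) - s / 2 * \<bar>x1 - x2\<bar>\<^sup>2)"

definition vector_norm :: "('a::real_vector \<Rightarrow> real) \<Rightarrow> bool" where
  "vector_norm N \<longleftrightarrow>
     (\<forall>v. 0 \<le> N v) \<and> (\<forall>v. N v = 0 \<longleftrightarrow> v = 0) \<and>
     (\<forall>r v. N (r *\<^sub>R v) = \<bar>r\<bar> * N v) \<and> (\<forall>v w. N (v + w) \<le> N v + N w)"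

text \<open>The stacked gradient \<open>[f\<^sub>1'(v\<^sub>1), \<dots>, f\<^sub>n'(v\<^sub>n)]\<close>.\<close>

definition grad_vec :: "('n \<Rightarrow> real \<Rightarrow> real) \<Rightarrow> real ^ 'n \<Rightarrow> real ^ 'n" where
  "grad_vec f v = (\<chi> i. deriv (f i) (v $ i))"

definition algorithm_iterates ::
  "real ^ 'n ^ 'n \<Rightarrow> real \<Rightarrow> ('n::finite \<Rightarrow> real \<Rightarrow> real) \<Rightarrow>
   (nat \<Rightarrow> real ^ 'n) \<Rightarrow> (nat \<Rightarrow> real ^ 'n ^ 'n) \<Rightarrow> (nat \<Rightarrow> real ^ 'n) \<Rightarrow> bool" where
  "algorithm_iterates A \<alpha> f x Y z \<longleftrightarrow>
     Y 0 = mat 1 \<and> z 0 = grad_vec f (x 0) \<and>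
     (\<forall>k. x (Suc k) = A *v x k - \<alpha> *\<^sub>R z k) \<and>
     (\<forall>k. Y (Suc k) = A ** Y k) \<and>
     (\<forall>k. z (Suc k) = A *v z k
              + matrix_inv (diag_part (Y (Suc k))) *v grad_vec f (x (Suc k))
              - matrix_inv (diag_part (Y k)) *v grad_vec f (x k))"

end

theory Submission
  imports Defs
begin

text \<open>
  Three errors govern the iteration: the consensus error \<open>\<parallel>x\<^sub>k - Y\<^sub>\<infinity> x\<^sub>k\<parallel>\<close>, the optimality error
  \<open>\<parallel>Y\<^sub>\<infinity> x\<^sub>k - x\<^sup>*\<parallel>\<^sub>2\<close> of the weighted average, and the tracking error \<open>\<parallel>z\<^sub>k - Y\<^sub>\<infinity> z\<^sub>k\<parallel>\<close>. Strong
  connectivity forces \<open>Y\<^sub>\<infinity>\<close> to be the all-ones column times a positive probability row \<open>\<pi>\<close>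
  (\<open>limit_of_powers\<close>). Since \<open>Y\<^sub>\<infinity> A = Y\<^sub>\<infinity>\<close>, the updates of \<open>z\<close> telescope under \<open>Y\<^sub>\<infinity>\<close>:
  \<open>Y\<^sub>\<infinity> z\<^sub>k\<close> equals \<open>Y\<^sub>\<infinity>\<close> applied to the gradients at step \<open>k\<close>, each divided by a diagonal entry of
  \<open>A\<^sup>k\<close>. These entries tend to \<open>\<pi>\<close> at the rate \<open>\<gamma>\<^sub>1\<close>, so the weights \<open>\<pi>\<^sub>i\<close> cancel in the limit and
  the average makes a gradient step on \<open>\<Sum>\<^sub>i f\<^sub>i\<close>, up to the consensus error and a perturbation of
  size \<open>\<gamma>\<^sub>1\<^sup>k\<close> times the norm of the gradients. That step contracts the optimality error by \<open>\<eta>\<close>.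
  Collecting the three estimates, the vector \<open>t\<^sub>k\<close> of errors satisfies, componentwise,
  \<open>t\<^sub>k\<^sub>+\<^sub>1 \<le> G t\<^sub>k + C \<gamma>\<^sub>1\<^sup>k (1 + \<parallel>t\<^sub>k\<parallel>)\<close> (\<open>err_recursion\<close>).

  It remains to study this recursion. The quadratic inequality whose positive root is the step-size
  bound says exactly that a positive vector \<open>v\<close> with \<open>G v < v\<close> can be written down
  (\<open>tracking_matrix_subinvariant\<close>); as \<open>G\<close> is nonnegative, this makes its powers decay
  geometrically. Moreover, given any bound \<open>\<parallel>G\<^sup>k\<parallel> \<le> \<Gamma> \<gamma>\<^sub>2\<^sup>k\<close>, the functional
  \<open>sup\<^sub>j \<parallel>G\<^sup>j u\<parallel> / \<gamma>\<^sub>2\<^sup>j\<close> is a norm equivalent to the Euclidean one in which \<open>G\<close> contracts by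
  \<open>\<gamma>\<^sub>2\<close> itself, and it is monotone on nonnegative vectors. The recursion becomes
  \<open>w\<^sub>k\<^sub>+\<^sub>1 \<le> (\<gamma>\<^sub>2 + C \<gamma>\<^sub>1\<^sup>k) w\<^sub>k + C \<gamma>\<^sub>1\<^sup>k\<close>. The coefficient \<open>C \<gamma>\<^sub>1\<^sup>k\<close> is eventually below any
  \<open>\<xi>/2\<close>, and the inhomogeneous term decays no slower than the claimed rate, so the rate is at most
  \<open>max \<gamma>\<^sub>1 \<gamma>\<^sub>2 + \<xi>\<close> (\<open>perturbed_linear_recursion\<close>).
\<close>

section \<open>Matrices and their operator norm\<close>

lemma norm_mult_le_mat_norm2: "norm (B *v v) \<le> mat_norm2 B * norm v"
  unfolding mat_norm2_def by (rule onorm) (rule matrix_vector_mul_bounded_linear)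

lemma mat_norm2_nonneg: "0 \<le> mat_norm2 B"
  unfolding mat_norm2_def by (rule onorm_pos_le) (rule matrix_vector_mul_bounded_linear)

lemma mat_norm2_le: "(\<And>v. norm (B *v v) \<le> b * norm v) \<Longrightarrow> mat_norm2 B \<le> b"
  unfolding mat_norm2_def by (rule onorm_le)

lemma component_le_mat_norm2:
  fixes B :: "real ^ 'n ^ 'n"
  shows "\<bar>B $ i $ j\<bar> \<le> mat_norm2 B"
  unfolding mat_norm2_def by (rule matrix_component_le_onorm)

lemma matpow_Suc_right: "matpow A (Suc k) = matpow A k ** A"
  by (induction k) (simp_all, metis matrix_mul_assoc)

lemma matpow_nonneg:
  assumes "\<And>i j. 0 \<le> A $ i $ j"
  shows "0 \<le> matpow A k $ i $ j"
  using assms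
  by (induction k arbitrary: i j) (auto simp: mat_def matrix_matrix_mult_def intro!: sum_nonneg)

lemma norm_vec: "norm (vec a :: real ^ 'n) = sqrt (real CARD('n)) * \<bar>a\<bar>"
  by (simp add: norm_vec_def L2_set_def real_sqrt_mult)

lemma abs_sum_components_le:
  fixes v :: "real ^ 'n"
  shows "\<bar>\<Sum>i\<in>UNIV. v $ i\<bar> \<le> sqrt (real CARD('n)) * norm v"
  using Cauchy_Schwarz_ineq2[of "vec 1" v] norm_vec[of 1, where 'n='n]
  by (simp add: inner_vec_def)

lemma norm_vec_sum_le:
  fixes v :: "real ^ 'n"
  shows "norm (vec (\<Sum>i\<in>UNIV. v $ i) :: real ^ 'n) \<le> real CARD('n) * norm v"
proof -
  have "norm (vec (\<Sum>i\<in>UNIV. v $ i) :: real ^ 'n)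
      \<le> sqrt (real CARD('n)) * (sqrt (real CARD('n)) * norm v)"
    unfolding norm_vec by (intro mult_left_mono abs_sum_components_le) simp
  then show ?thesis
    by (simp add: mult.assoc[symmetric])
qed

lemma norm_scaled_components_le:
  fixes v :: "real ^ 'n"
  assumes "\<And>i. \<bar>a i\<bar> \<le> b"
  shows "norm (\<chi> i. a i * v $ i) \<le> b * norm v"
proof -
  have b: "0 \<le> b" using assms[of undefined] by linarith
  have "norm (\<chi> i. a i * v $ i) \<le> norm (b *\<^sub>R v)"
    by (rule norm_le_componentwise_cart)
      (use assms b in \<open>auto simp: abs_mult intro: mult_right_mono\<close>)
  then show ?thesis using b by simp
qed

lemma matrix_inv_eqI:
  fixes B D :: "real ^ 'n ^ 'n"
  assumes "B ** D = mat 1" "D ** B = mat 1"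
  shows "matrix_inv B = D"
proof -
  have "matrix_inv B ** B = mat 1"
    unfolding matrix_inv_def by (rule someI2[of _ D]) (use assms in auto)
  then have "(matrix_inv B ** B) ** D = D" by simp
  then show ?thesis by (simp add: matrix_mul_assoc[symmetric] assms)
qed

lemma matrix_inv_diag_part_mult:
  fixes B :: "real ^ 'n ^ 'n"
  assumes "\<And>i. B $ i $ i \<noteq> 0"
  shows "matrix_inv (diag_part B) *v v = (\<chi> i. inverse (B $ i $ i) * v $ i)"
proof -
  define D :: "real ^ 'n ^ 'n" where "D = (\<chi> i j. if i = j then inverse (B $ i $ i) else 0)"
  have "diag_part B ** D = mat 1" "D ** diag_part B = mat 1"
    using assms
    by (auto simp: D_def diag_part_def matrix_matrix_mult_def mat_def vec_eq_iff
        if_distrib[where f="\<lambda>x. x * _"] if_distrib[where f="\<lambda>x. _ * x"] cong: if_cong)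
  then have "matrix_inv (diag_part B) = D"
    by (rule matrix_inv_eqI)
  then show ?thesis
    by (auto simp: D_def matrix_vector_mult_def vec_eq_iff
        if_distrib[where f="\<lambda>x. x * _"] cong: if_cong)
qed

section \<open>Powers of a strongly connected weight matrix\<close>

lemma row_stochastic_weights_nonneg:
  assumes "row_stochastic_weights E A" shows "0 \<le> A $ i $ j"
  using assms unfolding row_stochastic_weights_def
  by (metis order.strict_implies_order order_refl)

lemma row_stochastic_weights_edge:
  assumes "row_stochastic_weights E A" "(i, j) \<in> E" shows "0 < A $ i $ j"
  using assms unfolding row_stochastic_weights_def in_neighbours_def by blast

lemma row_stochastic_weights_diag:
  assumes "row_stochastic_weights E A" shows "0 < A $ i $ i"
  using assms unfolding row_stochastic_weights_def in_neighbours_def by blast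

lemma row_stochastic_weights_sum:
  assumes "row_stochastic_weights E A" shows "(\<Sum>j\<in>UNIV. A $ i $ j) = 1"
  using assms unfolding row_stochastic_weights_def by blast

lemma row_stochastic_mult_vec:
  assumes "row_stochastic_weights E A"
  shows "A *v vec a = vec a"
  using row_stochastic_weights_sum[OF assms]
  by (simp add: matrix_vector_mult_def vec_eq_iff sum_distrib_right[symmetric])

lemma matpow_mult_vec:
  assumes "row_stochastic_weights E A"
  shows "matpow A k *v vec a = vec a"
  by (induction k)
    (simp_all add: matrix_vector_mul_assoc[symmetric] row_stochastic_mult_vec[OF assms])

lemma matpow_diag_pos:
  assumes "row_stochastic_weights E A"
  shows "0 < matpow A k $ i $ i"
proof (induction k)
  case 0
  then show ?case by (simp add: mat_def)
next
  case (Suc k)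
  have "0 < A $ i $ i * matpow A k $ i $ i"
    using Suc row_stochastic_weights_diag[OF assms] by simp
  also have "\<dots> \<le> (\<Sum>j\<in>UNIV. A $ i $ j * matpow A k $ j $ i)"
    by (rule member_le_sum)
      (auto intro!: mult_nonneg_nonneg matpow_nonneg row_stochastic_weights_nonneg[OF assms])
  finally show ?case by (simp add: matrix_matrix_mult_def)
qed

text \<open>A discrete maximum principle: where a fixed vector attains its maximum, its value is an average
  with positive weights of values that are no larger, so all in-neighbours attain the maximum too.\<close>

lemma fixed_vector_constant:
  fixes A :: "real ^ 'n ^ 'n"
  assumes E: "strongly_connected E" and A: "row_stochastic_weights E A"
    and v: "A *v v = v"
  shows "v $ i = v $ j"
proof -
  define m where "m = Max (range (\<lambda>i. v $ i))"
  have le: "v $ i \<le> m" for i by (simp add: m_def)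
  have step: "v $ j = m" if "v $ i = m" "(i, j) \<in> E" for i j
  proof -
    have "(\<Sum>j\<in>UNIV. A $ i $ j * (m - v $ j)) = m - (A *v v) $ i"
      using row_stochastic_weights_sum[OF A, of i]
      by (simp add: matrix_vector_mult_def right_diff_distrib sum_subtractf
          sum_distrib_right[symmetric])
    also have "\<dots> = 0" using v that by simp
    finally have "(\<Sum>j\<in>UNIV. A $ i $ j * (m - v $ j)) = 0" .
    then have "A $ i $ j * (m - v $ j) = 0"
      using le row_stochastic_weights_nonneg[OF A]
      by (subst (asm) sum_nonneg_eq_0_iff) auto
    with row_stochastic_weights_edge[OF A that(2)] show ?thesis by simp
  qed
  obtain i0 where i0: "v $ i0 = m"
    using Max_in[of "range (\<lambda>i. v $ i)"] unfolding m_def by (metis UNIV_I finite_class.finite_UNIV finite_imageI image_iff image_is_empty UNIV_not_empty)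
  have "v $ j = m" for j
  proof -
    have "(i0, j) \<in> E\<^sup>*" using E by (simp add: strongly_connected_def)
    then show ?thesis by (induction rule: rtrancl_induct) (use i0 step in auto)
  qed
  then show ?thesis by simp
qed

text \<open>Mass of a stationary row at \<open>i\<close> is passed on to every \<open>j\<close> with an edge \<open>(i, j)\<close>; strong
  connectivity spreads it everywhere.\<close>

lemma stationary_row_pos:
  fixes A :: "real ^ 'n ^ 'n"
  assumes E: "strongly_connected E" and A: "row_stochastic_weights E A"
    and p: "p v* A = p" "\<And>i. 0 \<le> p $ i" "(\<Sum>i\<in>UNIV. p $ i) = 1"
  shows "0 < p $ i"
proof -
  have step: "0 < p $ j" if "0 < p $ i" "(i, j) \<in> E" for i j
  proof -
    have "0 < A $ i $ j * p $ i"
      using row_stochastic_weights_edge[OF A that(2)] that(1) by simp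
    also have "\<dots> \<le> (\<Sum>i\<in>UNIV. A $ i $ j * p $ i)"
      by (rule member_le_sum)
        (auto intro!: mult_nonneg_nonneg p row_stochastic_weights_nonneg[OF A])
    also have "\<dots> = (p v* A) $ j"
      by (simp add: vector_matrix_mult_def mult.commute)
    finally show ?thesis using p(1) by simp
  qed
  obtain i0 where i0: "0 < p $ i0"
    using p(2,3) sum_nonpos[of UNIV "\<lambda>i. p $ i"] by (metis not_one_le_zero not_less)
  have "(i0, i) \<in> E\<^sup>*" using E by (simp add: strongly_connected_def)
  then show ?thesis by (induction rule: rtrancl_induct) (use i0 step in auto)
qed

text \<open>Passing to the limit in \<open>A\<^sup>k\<^sup>+\<^sup>1 = A A\<^sup>k = A\<^sup>k A\<close> makes the columns of the limit right fixed vectors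
  of \<open>A\<close>, hence constant, and its common row a left fixed vector, hence positive.\<close>

lemma limit_of_powers:
  fixes A Yinf :: "real ^ 'n ^ 'n"
  assumes E: "strongly_connected E" and A: "row_stochastic_weights E A"
    and lim: "\<And>i j. (\<lambda>k. matpow A k $ i $ j) \<longlonglongrightarrow> Yinf $ i $ j"
  obtains p where "\<And>i. 0 < p $ i" "(\<Sum>i\<in>UNIV. p $ i) = 1"
    "\<And>i j. Yinf $ i $ j = p $ j" "Yinf ** A = Yinf"
proof -
  have lim_Suc: "(\<lambda>k. matpow A (Suc k) $ i $ j) \<longlonglongrightarrow> Yinf $ i $ j" for i j
    using lim by (rule LIMSEQ_Suc)
  have AY: "A ** Yinf = Yinf"
  proof -
    have "(\<lambda>k. matpow A (Suc k) $ i $ j) \<longlonglongrightarrow> (A ** Yinf) $ i $ j" for i j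
      by (auto simp: matrix_matrix_mult_def intro!: tendsto_intros lim)
    from LIMSEQ_unique[OF this lim_Suc] show ?thesis by (simp add: vec_eq_iff)
  qed
  have YA: "Yinf ** A = Yinf"
  proof -
    have "(\<lambda>k. matpow A (Suc k) $ i $ j) \<longlonglongrightarrow> (Yinf ** A) $ i $ j" for i j
      unfolding matpow_Suc_right
      by (auto simp: matrix_matrix_mult_def intro!: tendsto_intros lim)
    from LIMSEQ_unique[OF this lim_Suc] show ?thesis by (simp add: vec_eq_iff)
  qed
  define p where "p = Yinf $ undefined"
  have rows: "Yinf $ i $ j = p $ j" for i j
  proof -
    have "A *v column j Yinf = column j Yinf"
      using AY by (auto simp: vec_eq_iff column_def matrix_vector_mult_def matrix_matrix_mult_def)
    from fixed_vector_constant[OF E A this, of i undefined] show ?thesis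
      by (simp add: column_def p_def)
  qed
  have nonneg: "0 \<le> p $ j" for j
    using LIMSEQ_le_const[OF lim[of undefined j], of 0]
      matpow_nonneg[OF row_stochastic_weights_nonneg[OF A]] by (auto simp: p_def)
  have row_sum: "(\<Sum>j\<in>UNIV. p $ j) = 1"
  proof -
    have "(\<lambda>k. \<Sum>j\<in>UNIV. matpow A k $ undefined $ j) \<longlonglongrightarrow> (\<Sum>j\<in>UNIV. p $ j)"
      unfolding p_def by (intro tendsto_intros lim)
    moreover have "(\<Sum>j\<in>UNIV. matpow A k $ undefined $ j) = 1" for k
      using matpow_mult_vec[OF A, of k 1] by (simp add: vec_eq_iff matrix_vector_mult_def)
    ultimately show ?thesis by (simp add: LIMSEQ_const_iff)
  qed
  have "p v* A = p"
    using YA rows by (auto simp: vec_eq_iff vector_matrix_mult_def matrix_matrix_mult_def mult.commute)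
  from stationary_row_pos[OF E A this nonneg row_sum] row_sum rows YA show thesis
    by (rule that)
qed

section \<open>Inverses of the diagonals of the powers\<close>

text \<open>Self-loops keep every diagonal entry of \<open>A\<^sup>k\<close> positive, and the limits of these entries are
  positive as well, so their inverses converge. Boundedness above is what makes the supremum
  defining \<open>ytil\<close> an upper bound.\<close>

lemma inverse_diag_bounded:
  fixes A :: "real ^ 'n ^ 'n"
  assumes A: "row_stochastic_weights E A"
    and lim: "\<And>i. (\<lambda>k. matpow A k $ i $ i) \<longlonglongrightarrow> p $ i" and p: "\<And>i. 0 < p $ i"
  obtains B where "0 < B" "\<And>k i. \<bar>inverse (matpow A k $ i $ i)\<bar> \<le> B"
    "bdd_above (range (\<lambda>k. mat_norm2 (matrix_inv (diag_part (matpow A k)))))"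
proof -
  have "\<forall>i. \<exists>b>0. \<forall>k. \<bar>inverse (matpow A k $ i $ i)\<bar> \<le> b"
  proof
    fix i
    have "(\<lambda>k. inverse (matpow A k $ i $ i)) \<longlonglongrightarrow> inverse (p $ i)"
      using p[of i] by (intro tendsto_inverse lim) simp
    then have "Bseq (\<lambda>k. inverse (matpow A k $ i $ i))"
      by (intro convergent_imp_Bseq) (auto simp: convergent_def)
    then show "\<exists>b>0. \<forall>k. \<bar>inverse (matpow A k $ i $ i)\<bar> \<le> b"
      by (simp add: Bseq_def)
  qed
  then obtain b where b: "\<And>i. 0 < b i" "\<And>i k. \<bar>inverse (matpow A k $ i $ i)\<bar> \<le> b i"
    by metis
  have bB: "b i \<le> (\<Sum>i\<in>UNIV. b i)" for i
    using b(1) by (intro member_le_sum) (auto simp: less_imp_le)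
  have bound: "\<bar>inverse (matpow A k $ i $ i)\<bar> \<le> (\<Sum>i\<in>UNIV. b i)" for k i
    using b(2)[where i=i and k=k] bB[of i] by linarith
  moreover have "mat_norm2 (matrix_inv (diag_part (matpow A k))) \<le> (\<Sum>i\<in>UNIV. b i)" for k
    using matpow_diag_pos[OF A] bound
    by (intro mat_norm2_le)
      (simp add: matrix_inv_diag_part_mult less_imp_neq[THEN not_sym] norm_scaled_components_le del: abs_inverse)
  then have "bdd_above (range (\<lambda>k. mat_norm2 (matrix_inv (diag_part (matpow A k)))))"
    by (intro bdd_aboveI[where M="\<Sum>i\<in>UNIV. b i"]) auto
  moreover have "0 < (\<Sum>i\<in>UNIV. b i)" using b(1) by (intro sum_pos) auto
  ultimately show thesis using that by blast
qed

lemma inverse_diag_geometric: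
  fixes A :: "real ^ 'n ^ 'n"
  assumes A: "row_stochastic_weights E A" and p: "\<And>i. 0 < p $ i"
    and rate: "0 < \<gamma>" "\<gamma> < 1" "0 < T" "\<And>k i. \<bar>matpow A k $ i $ i - p $ i\<bar> \<le> T * \<gamma> ^ k"
    and B: "0 < B" "\<And>k i. \<bar>inverse (matpow A k $ i $ i)\<bar> \<le> B"
  obtains C where "0 < C"
    "\<And>k i. \<bar>inverse (matpow A k $ i $ i) - inverse (p $ i)\<bar> \<le> C * \<gamma> ^ k"
proof -
  define q where "q = (\<Sum>i\<in>UNIV. inverse (p $ i))"
  have q: "inverse (p $ i) \<le> q" for i
    unfolding q_def using p by (intro member_le_sum) (auto simp: less_imp_le)
  have qpos: "0 < q" unfolding q_def using p by (intro sum_pos) auto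
  have "\<bar>inverse (matpow A k $ i $ i) - inverse (p $ i)\<bar> \<le> (B * T * q) * \<gamma> ^ k" for k i
  proof -
    have "\<bar>inverse (matpow A k $ i $ i) - inverse (p $ i)\<bar>
        = \<bar>inverse (matpow A k $ i $ i)\<bar> * \<bar>matpow A k $ i $ i - p $ i\<bar> * \<bar>inverse (p $ i)\<bar>"
      using matpow_diag_pos[OF A, where k=k and i=i] p[of i]
      by (subst inverse_diff_inverse) (auto simp: abs_mult)
    also have "\<dots> \<le> B * (T * \<gamma> ^ k) * q"
      using rate B p[of i] q[of i] qpos by (intro mult_mono B rate) auto
    finally show ?thesis by (simp add: algebra_simps)
  qed
  moreover have "0 < B * T * q" using rate B qpos by simp
  ultimately show thesis using that by blast
qed

text \<open>The inverse diagonals \<open>W k\<close> approach \<open>diag(1/p\<^sub>i)\<close> at the rate of \<open>A\<^sup>k\<close>. Since the rows of \<open>Yinf\<close>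
  are \<open>p\<close>, multiplying by \<open>W k\<close> undoes the imbalance of the weighted average: \<open>Yinf W k\<close>
  approaches the all-ones matrix, which sends \<open>v\<close> to \<open>vec (\<Sum>i\<in>UNIV. v $ i)\<close>.\<close>

lemma diag_inverse_weights:
  fixes A Yinf :: "real ^ 'n ^ 'n"
  defines "W \<equiv> \<lambda>k. matrix_inv (diag_part (matpow A k))"
  assumes E: "strongly_connected E" and A: "row_stochastic_weights E A"
    and \<gamma>: "0 < \<gamma>" "\<gamma> < 1" and T: "0 < T"
    and rate: "\<And>k. mat_norm2 (matpow A k - Yinf) \<le> T * \<gamma> ^ k"
  obtains p C where "\<And>i j. Yinf $ i $ j = p $ j" "Yinf ** A = Yinf"
    "bdd_above (range (\<lambda>k. mat_norm2 (W k)))" "0 \<le> C"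
    "\<And>k v. norm (W (Suc k) *v v - W k *v v) \<le> C * \<gamma> ^ k * norm v"
    "\<And>k v. norm (Yinf *v (W k *v v) - vec (\<Sum>i\<in>UNIV. v $ i)) \<le> C * \<gamma> ^ k * norm v"
proof -
  have entry: "\<bar>matpow A k $ i $ j - Yinf $ i $ j\<bar> \<le> T * \<gamma> ^ k" for k i j
    using component_le_mat_norm2[of "matpow A k - Yinf" i j] rate[of k] by simp
  have lim: "(\<lambda>k. matpow A k $ i $ j) \<longlonglongrightarrow> Yinf $ i $ j" for i j
  proof -
    have "(\<lambda>k. T * \<gamma> ^ k) \<longlonglongrightarrow> T * 0"
      using \<gamma> by (intro tendsto_intros LIMSEQ_power_zero) simp
    then have "(\<lambda>k. T * \<gamma> ^ k) \<longlonglongrightarrow> 0" by simp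
    moreover have "\<forall>\<^sub>F k in sequentially. norm (matpow A k $ i $ j - Yinf $ i $ j) \<le> T * \<gamma> ^ k"
      unfolding real_norm_def by (intro always_eventually allI entry)
    ultimately have "(\<lambda>k. matpow A k $ i $ j - Yinf $ i $ j) \<longlonglongrightarrow> 0"
      by (rule Lim_null_comparison[rotated])
    then show ?thesis by (rule LIM_zero_cancel)
  qed
  obtain p where p: "\<And>i. 0 < p $ i" "(\<Sum>i\<in>UNIV. p $ i) = 1"
    and rows: "\<And>i j. Yinf $ i $ j = p $ j" and YA: "Yinf ** A = Yinf"
    by (rule limit_of_powers[OF E A lim]) (rule that)
  have diag_lim: "(\<lambda>k. matpow A k $ i $ i) \<longlonglongrightarrow> p $ i" for i
    using lim[of i i] by (simp add: rows)
  obtain B where B: "0 < B" "\<And>k i. \<bar>inverse (matpow A k $ i $ i)\<bar> \<le> B"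
    and bdd_inv: "bdd_above (range (\<lambda>k. mat_norm2 (matrix_inv (diag_part (matpow A k)))))"
    by (rule inverse_diag_bounded[OF A diag_lim p(1)]) (rule that)
  have bdd: "bdd_above (range (\<lambda>k. mat_norm2 (W k)))"
    unfolding W_def by (rule bdd_inv)
  have diag_rate: "\<bar>matpow A k $ i $ i - p $ i\<bar> \<le> T * \<gamma> ^ k" for k i
    using entry[of k i i] by (simp add: rows)
  obtain C0 where C0: "0 < C0"
    and inv_rate: "\<And>k i. \<bar>inverse (matpow A k $ i $ i) - inverse (p $ i)\<bar> \<le> C0 * \<gamma> ^ k"
    by (rule inverse_diag_geometric[OF A p(1) \<gamma> T diag_rate B]) (rule that)
  have W: "W k *v v = (\<chi> i. inverse (matpow A k $ i $ i) * v $ i)" for k v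
    unfolding W_def using matpow_diag_pos[OF A] by (intro matrix_inv_diag_part_mult) (simp add: less_imp_neq[THEN not_sym])
  define C where "C = (real CARD('n) + 2) * C0"
  \<comment> \<open>The increments cost \<open>2 C0\<close> and the limit \<open>CARD('n) C0\<close>; one constant serves both.\<close>
  have step: "norm (W (Suc k) *v v - W k *v v) \<le> C * \<gamma> ^ k * norm v" for k v
  proof -
    have "W (Suc k) *v v - W k *v v
        = (\<chi> i. (inverse (matpow A (Suc k) $ i $ i) - inverse (matpow A k $ i $ i)) * v $ i)"
      unfolding W by (simp add: vec_eq_iff left_diff_distrib)
    also have "norm \<dots> \<le> (C * \<gamma> ^ k) * norm v"
    proof (rule norm_scaled_components_le)
      fix i
      have "\<gamma> ^ Suc k \<le> \<gamma> ^ k" using \<gamma> by (simp add: mult_left_le_one_le)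
      then have "C0 * \<gamma> ^ Suc k \<le> C0 * \<gamma> ^ k" using C0 by (intro mult_left_mono) auto
      with inv_rate[of "Suc k" i] inv_rate[of k i]
      have "\<bar>inverse (matpow A (Suc k) $ i $ i) - inverse (matpow A k $ i $ i)\<bar> \<le> 2 * (C0 * \<gamma> ^ k)"
        by linarith
      also have "\<dots> \<le> C * \<gamma> ^ k" using C0 \<gamma> by (simp add: C_def algebra_simps)
      finally show "\<bar>inverse (matpow A (Suc k) $ i $ i) - inverse (matpow A k $ i $ i)\<bar> \<le> C * \<gamma> ^ k" .
    qed
    finally show ?thesis .
  qed
  have limit: "norm (Yinf *v (W k *v v) - vec (\<Sum>i\<in>UNIV. v $ i)) \<le> C * \<gamma> ^ k * norm v" for k v
  proof -
    define u :: "real ^ 'n" where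
      "u = (\<chi> i. (p $ i * (inverse (matpow A k $ i $ i) - inverse (p $ i))) * v $ i)"
    have "u $ i = p $ i * (inverse (matpow A k $ i $ i) * v $ i) - v $ i" for i
      using p(1)[of i] by (simp add: u_def algebra_simps)
    moreover have "Yinf *v y = vec (\<Sum>i\<in>UNIV. p $ i * y $ i)" for y
      by (simp add: vec_eq_iff matrix_vector_mult_def rows)
    ultimately have "Yinf *v (W k *v v) - vec (\<Sum>i\<in>UNIV. v $ i) = vec (\<Sum>i\<in>UNIV. u $ i)"
      unfolding W by (simp add: vec_eq_iff sum_subtractf)
    also have "norm (vec (\<Sum>i\<in>UNIV. u $ i) :: real ^ 'n) \<le> real CARD('n) * norm u"
      by (rule norm_vec_sum_le)
    also have "\<dots> \<le> real CARD('n) * (C0 * \<gamma> ^ k * norm v)"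
    proof (intro mult_left_mono)
      show "norm u \<le> C0 * \<gamma> ^ k * norm v"
        unfolding u_def
      proof (rule norm_scaled_components_le)
        fix i
        have "p $ i \<le> 1"
          unfolding p(2)[symmetric] using p(1) by (intro member_le_sum) (auto simp: less_imp_le)
        then have "p $ i * \<bar>inverse (matpow A k $ i $ i) - inverse (p $ i)\<bar> \<le> 1 * (C0 * \<gamma> ^ k)"
          using p(1)[of i] by (intro mult_mono inv_rate) auto
        then show "\<bar>p $ i * (inverse (matpow A k $ i $ i) - inverse (p $ i))\<bar> \<le> C0 * \<gamma> ^ k"
          using p(1)[of i] by (simp add: abs_mult)
      qed
    qed simp
    also have "\<dots> \<le> C * \<gamma> ^ k * norm v"
      using C0 \<gamma> by (simp add: C_def algebra_simps)
    finally show ?thesis .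
  qed
  have "0 \<le> C" using C0 by (simp add: C_def)
  from rows YA bdd this step limit show thesis by (rule that)
qed

section \<open>Strongly convex functions of one variable\<close>

text \<open>The strong convexity inequalities at \<open>(u, v)\<close> and \<open>(v, u)\<close> add up to this.\<close>

lemma strongly_convex_deriv_monotone:
  assumes "strongly_convex s g"
  shows "s * (u - v)\<^sup>2 \<le> (deriv g u - deriv g v) * (u - v)"
proof -
  have "g u - g v \<le> deriv g u * (u - v) - s / 2 * (u - v)\<^sup>2"
    "g v - g u \<le> deriv g v * (v - u) - s / 2 * (v - u)\<^sup>2"
    using assms unfolding strongly_convex_def by (metis power2_abs)+
  then show ?thesis
    by (simp add: power2_commute[of v u] algebra_simps)
qed

lemma strongly_convex_le_lipschitz:
  assumes "strongly_convex s g" "l-lipschitz_on UNIV (deriv g)"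
  shows "s \<le> l"
  using strongly_convex_deriv_monotone[OF assms(1), of 1 0] lipschitz_onD[OF assms(2), of 1 0]
  by (simp add: dist_real_def)

text \<open>In one dimension \<open>h u = q (u - w)\<close> for a secant slope \<open>q\<close> between \<open>m\<close> and \<open>L\<close>, so the step
  multiplies the distance to \<open>w\<close> by \<open>1 - a q\<close>, a value between \<open>1 - a L\<close> and \<open>1 - a m\<close>.\<close>

lemma gradient_step_contraction:
  fixes h :: "real \<Rightarrow> real"
  assumes "\<And>u v. m * (u - v)\<^sup>2 \<le> (h u - h v) * (u - v)"
    and "\<And>u v. \<bar>h u - h v\<bar> \<le> L * \<bar>u - v\<bar>" and "0 \<le> a" "h w = 0"
  shows "\<bar>u - a * h u - w\<bar> \<le> max \<bar>1 - a * L\<bar> \<bar>1 - a * m\<bar> * \<bar>u - w\<bar>"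
proof (cases "u = w")
  case True
  then show ?thesis using assms by simp
next
  case False
  define q where "q = h u / (u - w)"
  have hu: "h u = q * (u - w)" using False by (simp add: q_def)
  have "m * (u - w)\<^sup>2 \<le> q * (u - w)\<^sup>2"
    using assms(1)[of u w] \<open>h w = 0\<close> hu by (simp add: power2_eq_square)
  then have "m \<le> q" using False by simp
  moreover have "\<bar>q\<bar> * \<bar>u - w\<bar> \<le> L * \<bar>u - w\<bar>"
    using assms(2)[of u w] \<open>h w = 0\<close> hu by (simp add: abs_mult)
  then have "\<bar>q\<bar> \<le> L" using False by simp
  ultimately have "a * m \<le> a * q" "a * q \<le> a * L"
    using \<open>0 \<le> a\<close> by (auto intro!: mult_left_mono)
  then have "\<bar>1 - a * q\<bar> \<le> max \<bar>1 - a * L\<bar> \<bar>1 - a * m\<bar>" by linarith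
  moreover have "u - a * h u - w = (1 - a * q) * (u - w)"
    by (simp add: hu algebra_simps)
  ultimately show ?thesis by (simp add: abs_mult mult_right_mono)
qed

lemma sum_deriv_at_minimizer:
  fixes f :: "'n::finite \<Rightarrow> real \<Rightarrow> real"
  assumes diff: "\<And>i t. f i differentiable (at t)"
    and "is_arg_min (\<lambda>t. \<Sum>i\<in>UNIV. f i t) (\<lambda>_. True) w"
  shows "(\<Sum>i\<in>UNIV. deriv (f i) w) = 0"
proof (rule DERIV_local_min[where f="\<lambda>t. \<Sum>i\<in>UNIV. f i t" and d=1 and x=w])
  show "((\<lambda>t. \<Sum>i\<in>UNIV. f i t) has_real_derivative (\<Sum>i\<in>UNIV. deriv (f i) w)) (at w)"
    using diff by (intro DERIV_sum) (simp add: DERIV_deriv_iff_real_differentiable)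
  show "\<forall>y. \<bar>w - y\<bar> < 1 \<longrightarrow> (\<Sum>i\<in>UNIV. f i w) \<le> (\<Sum>i\<in>UNIV. f i y)"
    using assms(2) by (auto simp: is_arg_min_def not_less)
qed simp

lemma norm_grad_vec_diff_le:
  assumes "\<And>i. l-lipschitz_on UNIV (deriv (f i))"
  shows "norm (grad_vec f u - grad_vec f v) \<le> l * norm (u - v)"
proof -
  have l: "0 \<le> l" using assms lipschitz_on_nonneg by blast
  have "norm (grad_vec f u - grad_vec f v) \<le> norm (l *\<^sub>R (u - v))"
  proof (rule norm_le_componentwise_cart)
    fix i
    show "norm ((grad_vec f u - grad_vec f v) $ i) \<le> norm ((l *\<^sub>R (u - v)) $ i)"
      using lipschitz_onD[OF assms[of i], of "u $ i" "v $ i"] l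
      by (simp add: grad_vec_def dist_real_def abs_mult)
  qed
  then show ?thesis using l by simp
qed

section \<open>Perturbed linear recursions\<close>

text \<open>The slack \<open>\<xi>\<close> is spent in two halves once \<open>C \<gamma>1^k < \<xi>/2\<close>: one half absorbs the perturbation of
  the coefficient of \<open>w k\<close>, the other the inhomogeneous term, for which \<open>M\<close> has to dominate
  \<open>2 C / \<xi>\<close>. The finitely many earlier terms only enlarge \<open>M\<close>.\<close>

lemma perturbed_scalar_recursion:
  fixes w :: "nat \<Rightarrow> real"
  assumes w: "\<And>k. 0 \<le> w k"
    and rec: "\<And>k. w (Suc k) \<le> \<gamma>2 * w k + C * \<gamma>1 ^ k * (1 + w k)"
    and \<gamma>1: "0 < \<gamma>1" "\<gamma>1 < 1" and C: "0 \<le> C" and \<xi>: "0 < \<xi>"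
  shows "\<exists>M>0. \<forall>k. w k \<le> M * (max \<gamma>1 \<gamma>2 + \<xi>) ^ k"
proof -
  define \<rho> where "\<rho> = max \<gamma>1 \<gamma>2 + \<xi>"
  have \<rho>: "0 < \<rho>" "\<gamma>1 \<le> \<rho>" "\<gamma>2 + \<xi> \<le> \<rho>" using \<gamma>1 \<xi> by (auto simp: \<rho>_def)
  have "(\<lambda>k. C * \<gamma>1 ^ k) \<longlonglongrightarrow> C * 0"
    using \<gamma>1 by (intro tendsto_intros LIMSEQ_power_zero) simp
  then have "\<forall>\<^sub>F k in sequentially. C * \<gamma>1 ^ k < \<xi> / 2"
    using \<xi> by (intro order_tendstoD(2)[of _ "C * 0"]) auto
  then obtain k0 where k0: "C * \<gamma>1 ^ k < \<xi> / 2" if "k0 \<le> k" for k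
    by (auto simp: eventually_sequentially)
  define M where "M = 2 * C / \<xi> + 1 + (\<Sum>k\<le>k0. w k / \<rho> ^ k)"
  have sum_nonneg: "0 \<le> (\<Sum>k\<le>k0. w k / \<rho> ^ k)" using w \<rho> by (intro sum_nonneg) simp
  then have M: "0 < M" "C \<le> M * (\<xi> / 2)"
    using C \<xi> by (auto simp: M_def field_simps add_pos_nonneg)
  have start: "w k \<le> M * \<rho> ^ k" if "k \<le> k0" for k
  proof -
    have "w k / \<rho> ^ k \<le> (\<Sum>k\<le>k0. w k / \<rho> ^ k)"
      using that w \<rho> by (intro member_le_sum) auto
    also have "\<dots> \<le> M" using C \<xi> by (simp add: M_def)
    finally show ?thesis using \<rho> by (simp add: field_simps)
  qed
  have "w k \<le> M * \<rho> ^ k" for k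
  proof (induction k)
    case 0
    show ?case by (rule start) simp
  next
    case (Suc k)
    show ?case
    proof (cases "k0 \<le> k")
      case False
      then have "Suc k \<le> k0" by simp
      then show ?thesis by (rule start)
    next
      case True
      have "w (Suc k) \<le> (\<gamma>2 + C * \<gamma>1 ^ k) * w k + C * \<gamma>1 ^ k"
        using rec[of k] by (simp add: algebra_simps)
      also have "\<dots> \<le> (\<rho> - \<xi> / 2) * w k + C * \<rho> ^ k"
        using k0[OF True] \<rho> C \<gamma>1 w[of k]
        by (intro add_mono mult_right_mono mult_left_mono power_mono) auto
      also have "\<dots> \<le> (\<rho> - \<xi> / 2) * (M * \<rho> ^ k) + (M * (\<xi> / 2)) * \<rho> ^ k"
        using Suc M \<rho> \<gamma>1 by (intro add_mono mult_right_mono mult_left_mono) (auto simp: \<rho>_def)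
      also have "\<dots> = M * \<rho> ^ Suc k" by (simp add: algebra_simps)
      finally show ?thesis .
    qed
  qed
  then show ?thesis using M(1) unfolding \<rho>_def by blast
qed

lemma mat_vec_mono:
  fixes G :: "real ^ 'm ^ 'm"
  assumes "\<And>i j. 0 \<le> G $ i $ j" "\<And>i. u $ i \<le> v $ i"
  shows "(G *v u) $ i \<le> (G *v v) $ i"
  using assms by (auto simp: matrix_vector_mult_def intro!: sum_mono mult_left_mono)

lemma norm_mono_nonneg:
  fixes u v :: "real ^ 'm"
  assumes "\<And>i. 0 \<le> u $ i" "\<And>i. u $ i \<le> v $ i"
  shows "norm u \<le> norm v"
  using assms order_trans[OF assms] by (intro norm_le_componentwise_cart) simp

text \<open>The functional \<open>W\<close> below is a norm adapted to the decay of the powers of \<open>G\<close>. It absorbs the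
  constant \<open>\<Gamma>\<close>: in it, one application of \<open>G\<close> contracts by \<open>\<gamma>2\<close>. Nonnegativity of \<open>G\<close> makes it
  monotone on nonnegative vectors, so it can be applied to the componentwise inequality, which then
  becomes a scalar recursion.\<close>

lemma perturbed_linear_recursion:
  fixes G :: "real ^ 'm ^ 'm" and t :: "nat \<Rightarrow> real ^ 'm"
  assumes G: "\<And>i j. 0 \<le> G $ i $ j" and t: "\<And>k i. 0 \<le> t k $ i"
    and rec: "\<And>k i. t (Suc k) $ i \<le> (G *v t k) $ i + C * \<gamma>1 ^ k * (1 + norm (t k))"
    and pow: "\<And>k. mat_norm2 (matpow G k) \<le> \<Gamma> * \<gamma>2 ^ k"
    and \<gamma>1: "0 < \<gamma>1" "\<gamma>1 < 1" and \<gamma>2: "0 < \<gamma>2" and C: "0 \<le> C" and \<xi>: "0 < \<xi>"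
  shows "\<exists>M>0. \<forall>k. norm (t k) \<le> M * (max \<gamma>1 \<gamma>2 + \<xi>) ^ k"
proof -
  define W where "W u = (SUP j. norm (matpow G j *v u) / \<gamma>2 ^ j)" for u
  have bound: "norm (matpow G j *v u) / \<gamma>2 ^ j \<le> \<Gamma> * norm u" for j u
  proof -
    have "norm (matpow G j *v u) \<le> (\<Gamma> * \<gamma>2 ^ j) * norm u"
      by (rule order_trans[OF norm_mult_le_mat_norm2 mult_right_mono[OF pow]]) simp
    then show ?thesis using \<gamma>2 by (simp add: field_simps)
  qed
  have upper: "norm (matpow G j *v u) / \<gamma>2 ^ j \<le> W u" for j u
    unfolding W_def using bound by (intro cSUP_upper bdd_aboveI2) auto
  have W_le: "W u \<le> b" if "\<And>j. norm (matpow G j *v u) / \<gamma>2 ^ j \<le> b" for u b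
    unfolding W_def using that by (intro cSUP_least) auto
  have norm_le_W: "norm u \<le> W u" for u
    using upper[of 0 u] by simp
  have W_le_norm: "W u \<le> \<Gamma> * norm u" for u
    by (rule W_le) (rule bound)
  have W_G: "W (G *v u) \<le> \<gamma>2 * W u" for u
  proof (rule W_le)
    fix j
    have "norm (matpow G (Suc j) *v u) / \<gamma>2 ^ Suc j \<le> W u" by (rule upper)
    then show "norm (matpow G j *v (G *v u)) / \<gamma>2 ^ j \<le> \<gamma>2 * W u"
      using \<gamma>2 by (simp add: matpow_Suc_right matrix_vector_mul_assoc field_simps del: matpow.simps)
  qed
  have W_mono: "W u \<le> W v" if "\<And>i. 0 \<le> u $ i" "\<And>i. u $ i \<le> v $ i" for u v
  proof (rule W_le)
    fix j
    have "0 \<le> (matpow G j *v u) $ i" for i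
      using that G by (auto simp: matrix_vector_mult_def intro!: sum_nonneg mult_nonneg_nonneg matpow_nonneg)
    then have "norm (matpow G j *v u) \<le> norm (matpow G j *v v)"
      using that G by (intro norm_mono_nonneg mat_vec_mono matpow_nonneg) auto
    then have "norm (matpow G j *v u) / \<gamma>2 ^ j \<le> norm (matpow G j *v v) / \<gamma>2 ^ j"
      using \<gamma>2 by (simp add: divide_right_mono)
    also have "\<dots> \<le> W v" by (rule upper)
    finally show "norm (matpow G j *v u) / \<gamma>2 ^ j \<le> W v" .
  qed
  have W_add: "W (u + v) \<le> W u + W v" for u v
  proof (rule W_le)
    fix j
    have "norm (matpow G j *v (u + v)) / \<gamma>2 ^ j
        \<le> (norm (matpow G j *v u) + norm (matpow G j *v v)) / \<gamma>2 ^ j"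
      using \<gamma>2 by (intro divide_right_mono) (auto simp: matrix_vector_right_distrib norm_triangle_ineq)
    then show "norm (matpow G j *v (u + v)) / \<gamma>2 ^ j \<le> W u + W v"
      using upper[of j u] upper[of j v] by (simp add: add_divide_distrib)
  qed
  have \<Gamma>: "0 \<le> \<Gamma>" using pow[of 0] mat_norm2_nonneg[of "matpow G 0"] by simp
  define K where "K = C * \<Gamma> * sqrt (real CARD('m))"
  have "\<exists>M>0. \<forall>k. W (t k) \<le> M * (max \<gamma>1 \<gamma>2 + \<xi>) ^ k"
  proof (rule perturbed_scalar_recursion[OF _ _ \<gamma>1 _ \<xi>])
    show "0 \<le> W (t k)" for k using norm_le_W[of "t k"] norm_ge_zero order_trans by blast
    show "0 \<le> K" using C \<Gamma> by (simp add: K_def)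
    fix k
    define e where "e = C * \<gamma>1 ^ k * (1 + norm (t k))"
    have e: "0 \<le> e" using C \<gamma>1 by (simp add: e_def)
    have "W (t (Suc k)) \<le> W (G *v t k + vec e)"
      using t rec[of k] by (intro W_mono) (auto simp: e_def)
    also have "\<dots> \<le> \<gamma>2 * W (t k) + \<Gamma> * norm (vec e :: real ^ 'm)"
      by (rule order_trans[OF W_add add_mono[OF W_G W_le_norm]])
    also have "\<Gamma> * norm (vec e :: real ^ 'm) = K * \<gamma>1 ^ k * (1 + norm (t k))"
      using e by (simp add: norm_vec K_def e_def)
    also have "\<gamma>2 * W (t k) + K * \<gamma>1 ^ k * (1 + norm (t k))
        \<le> \<gamma>2 * W (t k) + K * \<gamma>1 ^ k * (1 + W (t k))"
      using norm_le_W \<open>0 \<le> K\<close> \<gamma>1 \<gamma>2 by (intro add_mono mult_left_mono) auto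
    finally show "W (t (Suc k)) \<le> \<gamma>2 * W (t k) + K * \<gamma>1 ^ k * (1 + W (t k))" .
  qed
  then show ?thesis using norm_le_W order_trans by meson
qed

section \<open>Stability of nonnegative matrices\<close>

text \<open>By induction \<open>G\<^sup>k v \<le> r\<^sup>k v\<close>; every vector is dominated by a multiple of the positive vector
  \<open>v\<close>, and by nonnegativity so are its images under the powers of \<open>G\<close>.\<close>

lemma matpow_geometric_if_subinvariant:
  fixes G :: "real ^ 'm ^ 'm"
  assumes G: "\<And>i j. 0 \<le> G $ i $ j" and v: "\<And>i. 0 < v $ i"
    and sub: "\<And>i. (G *v v) $ i \<le> r * v $ i" and r: "0 \<le> r"
  shows "\<exists>\<Gamma>>0. \<forall>k. mat_norm2 (matpow G k) \<le> \<Gamma> * r ^ k"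
proof -
  have pow: "(matpow G k *v v) $ i \<le> r ^ k * v $ i" for k i
  proof (induction k arbitrary: i)
    case (Suc k)
    have "(matpow G (Suc k) *v v) $ i = (G *v (matpow G k *v v)) $ i"
      by (simp add: matrix_vector_mul_assoc)
    also have "\<dots> \<le> (G *v (r ^ k *\<^sub>R v)) $ i"
      using Suc by (intro mat_vec_mono G) simp
    also have "\<dots> = r ^ k * (G *v v) $ i" by (simp add: matrix_vector_mult_scaleR)
    also have "\<dots> \<le> r ^ Suc k * v $ i"
      using mult_left_mono[OF sub[of i], of "r ^ k"] r by (simp add: mult.assoc mult.commute mult.left_commute)
    finally show ?case .
  qed simp
  define q where "q = (\<Sum>i\<in>UNIV. inverse (v $ i))"
  have q_nonneg: "0 \<le> q" unfolding q_def using v by (intro sum_nonneg) (simp add: less_imp_le)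
  have q: "1 \<le> q * v $ j" for j
  proof -
    have "inverse (v $ j) \<le> q"
      unfolding q_def using v by (intro member_le_sum) (auto simp: less_imp_le)
    then show ?thesis using v[of j] by (simp add: field_simps)
  qed
  have "mat_norm2 (matpow G k) \<le> (q * (\<Sum>i\<in>UNIV. v $ i)) * r ^ k" for k
  proof (rule mat_norm2_le)
    fix u :: "real ^ 'm"
    have comp: "\<bar>(matpow G k *v u) $ i\<bar> \<le> norm u * q * (r ^ k * v $ i)" for i
    proof -
      have "\<bar>(matpow G k *v u) $ i\<bar> \<le> (\<Sum>j\<in>UNIV. \<bar>matpow G k $ i $ j * u $ j\<bar>)"
        by (simp add: matrix_vector_mult_def)
      also have "\<dots> \<le> (\<Sum>j\<in>UNIV. matpow G k $ i $ j * (norm u * (q * v $ j)))"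
      proof (rule sum_mono)
        fix j
        have "\<bar>u $ j\<bar> * 1 \<le> norm u * (q * v $ j)"
          using q[of j] component_le_norm_cart[of u j] by (intro mult_mono) auto
        then show "\<bar>matpow G k $ i $ j * u $ j\<bar> \<le> matpow G k $ i $ j * (norm u * (q * v $ j))"
          using matpow_nonneg[OF G, of k i j] by (simp add: abs_mult mult_left_mono)
      qed
      also have "\<dots> = norm u * q * (matpow G k *v v) $ i"
        by (simp add: matrix_vector_mult_def sum_distrib_left mult.assoc mult.commute mult.left_commute)
      also have "\<dots> \<le> norm u * q * (r ^ k * v $ i)"
        using q_nonneg by (intro mult_left_mono pow) simp
      finally show ?thesis .
    qed
    have "norm (matpow G k *v u) \<le> (\<Sum>i\<in>UNIV. norm u * q * (r ^ k * v $ i))"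
      by (rule order_trans[OF norm_le_l1_cart sum_mono[OF comp]])
    then show "norm (matpow G k *v u) \<le> q * (\<Sum>i\<in>UNIV. v $ i) * r ^ k * norm u"
      by (simp add: sum_distrib_left sum_distrib_right mult.assoc mult.commute mult.left_commute)
  qed
  moreover have "0 < q * (\<Sum>i\<in>UNIV. v $ i)"
    unfolding q_def using v by (intro mult_pos_pos sum_pos) auto
  ultimately show ?thesis by blast
qed

lemma matpow_geometric_if_strictly_subinvariant:
  fixes G :: "real ^ 'm ^ 'm"
  assumes G: "\<And>i j. 0 \<le> G $ i $ j" and v: "\<And>i. 0 < v $ i"
    and sub: "\<And>i. (G *v v) $ i < v $ i"
  shows "\<exists>r \<Gamma>. 0 < r \<and> r < 1 \<and> 0 < \<Gamma> \<and> (\<forall>k. mat_norm2 (matpow G k) \<le> \<Gamma> * r ^ k)"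
proof -
  define r where "r = Max (insert (1/2) (range (\<lambda>i. (G *v v) $ i / v $ i)))"
  have r: "0 < r" "r < 1"
    unfolding r_def using sub v by (auto simp: Max_gr_iff)
  have "(G *v v) $ i / v $ i \<le> r" for i unfolding r_def by (intro Max_ge) auto
  then have "(G *v v) $ i \<le> r * v $ i" for i using v by (simp add: pos_divide_le_eq)
  with matpow_geometric_if_subinvariant[OF G v this] r show ?thesis by (meson less_imp_le)
qed

section \<open>The step-size bound\<close>

text \<open>The witness comes from solving the three inequalities in order. With \<open>v3 = 1 - \<sigma>\<close>, the first
  row asks for \<open>v1 > \<alpha>\<close> and the second for \<open>v2 > c l v1 / s\<close>. At the boundary values \<open>v1 = \<alpha>\<close>
  and \<open>v2 = c l \<alpha> / s\<close> the third row has the slack \<open>D\<close>, and \<open>n s D\<close> is the quadratic in \<open>\<alpha>\<close>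
  whose positive root bounds \<open>\<alpha>\<close>. A small \<open>\<delta>\<close> then makes the first two rows
  strict as well.

  Here \<open>K\<close> stands for \<open>c d \<epsilon> ytil\<close> and \<open>\<kappa>\<close> for \<open>d \<epsilon> ytil\<close>.\<close>

lemma tracking_matrix_subinvariant:
  fixes K \<kappa> \<alpha> \<tau> \<sigma> n l s c :: real
  assumes pos: "0 < K" "0 < c" "0 < n" "0 < l" "0 < s" "0 < \<alpha>" "0 \<le> \<tau>" "\<sigma> < 1"
    and \<kappa>: "\<kappa> * c = K"
    and \<Delta>: "\<Delta> = K * l * n * s * (\<tau> + 1 - \<sigma>)"
    and \<alpha>: "\<alpha> < (sqrt (\<Delta>\<^sup>2 + 4 * K * n ^ 3 * l\<^sup>2 * (l + s) * s * (1 - \<sigma>)\<^sup>2) - \<Delta>)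
         / (2 * K * n\<^sup>2 * l\<^sup>2 * (l + s))"
  obtains v1 v2 v3 where "0 < v1" "0 < v2" "0 < v3"
    "\<sigma> * v1 + \<alpha> * v3 < v1"
    "\<alpha> * c * n * l * v1 + (1 - \<alpha> * n * s) * v2 < v2"
    "K * l * (\<tau> + \<alpha> * n * l) * v1 + \<alpha> * \<kappa> * l\<^sup>2 * n * v2 + (\<sigma> + \<alpha> * K * l) * v3 < v3"
proof -
  define a where "a = K * n\<^sup>2 * l\<^sup>2 * (l + s)"
  define b where "b = n * s * (1 - \<sigma>)\<^sup>2"
  have a: "0 < a" using pos by (simp add: a_def)
  have "0 \<le> \<Delta>" using pos by (simp add: \<Delta>)
  have "\<alpha> < (sqrt (\<Delta>\<^sup>2 + 4 * a * b) - \<Delta>) / (2 * a)"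
    using \<alpha> by (simp add: a_def b_def power2_eq_square power3_eq_cube mult_ac)
  then have "\<alpha> * (2 * a) + \<Delta> < sqrt (\<Delta>\<^sup>2 + 4 * a * b)"
    using a by (simp add: pos_less_divide_eq)
  then have "(\<alpha> * (2 * a) + \<Delta>)\<^sup>2 < \<Delta>\<^sup>2 + 4 * a * b"
  proof -
    have "0 \<le> b" using pos by (simp add: b_def)
    have "(\<alpha> * (2 * a) + \<Delta>)\<^sup>2 < (sqrt (\<Delta>\<^sup>2 + 4 * a * b))\<^sup>2"
      using \<open>\<alpha> * (2 * a) + \<Delta> < _\<close> a pos \<open>0 \<le> \<Delta>\<close> by (intro power_strict_mono) auto
    then show ?thesis using a \<open>0 \<le> b\<close> by simp
  qed
  then have "4 * a * (a * \<alpha>\<^sup>2 + \<Delta> * \<alpha>) < 4 * a * b"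
    by (simp add: power2_eq_square algebra_simps)
  then have quad: "a * \<alpha>\<^sup>2 + \<Delta> * \<alpha> < b" using a by simp
  define D where "D = (1 - \<sigma>)\<^sup>2 - \<alpha> * K * l * (1 - \<sigma>) - \<alpha> * K * l * \<tau> - \<alpha>\<^sup>2 * K * n * l\<^sup>2 * (l + s) / s"
  have "n * s * D = b - \<Delta> * \<alpha> - a * \<alpha>\<^sup>2"
    using pos by (simp add: D_def a_def b_def \<Delta> field_simps power2_eq_square)
  then have "0 < n * s * D" using quad by simp
  then have D: "0 < D" using pos by (intro zero_less_mult_pos[of "n * s" D]) auto
  define q where "q = K * l * (\<tau> + \<alpha> * n * l) + 2 * \<alpha> * K * l ^ 3 * n / s"
  have q: "0 < q" using pos by (simp add: q_def add_pos_pos add_nonneg_pos)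
  define \<delta> where "\<delta> = D / (2 * q)"
  have \<delta>: "0 < \<delta>" "q * \<delta> < D" using D q by (auto simp: \<delta>_def)
  define v1 where "v1 = \<alpha> + \<delta>"
  define v2 where "v2 = c * l * (\<alpha> + 2 * \<delta>) / s"
  define v3 where "v3 = 1 - \<sigma>"
  have "0 < v1" "0 < v2" "0 < v3" using pos \<delta> by (auto simp: v1_def v2_def v3_def)
  moreover have "\<sigma> * v1 + \<alpha> * v3 < v1"
  proof -
    have "0 < (1 - \<sigma>) * \<delta>" using pos \<delta> by simp
    then show ?thesis by (simp add: v1_def v3_def algebra_simps)
  qed
  moreover have "\<alpha> * c * n * l * v1 + (1 - \<alpha> * n * s) * v2 < v2"
  proof -
    have "\<alpha> * n * s * v2 = \<alpha> * n * c * l * (\<alpha> + 2 * \<delta>)" using pos by (simp add: v2_def)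
    moreover have "0 < \<alpha> * n * c * l * \<delta>" using pos \<delta> by simp
    ultimately show ?thesis by (simp add: v1_def algebra_simps)
  qed
  moreover have "K * l * (\<tau> + \<alpha> * n * l) * v1 + \<alpha> * \<kappa> * l\<^sup>2 * n * v2 + (\<sigma> + \<alpha> * K * l) * v3 < v3"
  proof -
    have "\<alpha> * \<kappa> * l\<^sup>2 * n * v2 = \<alpha> * (\<kappa> * c) * l ^ 3 * n * (\<alpha> + 2 * \<delta>) / s"
      by (simp add: v2_def power2_eq_square power3_eq_cube)
    then have eq: "\<alpha> * \<kappa> * l\<^sup>2 * n * v2 = \<alpha> * K * l ^ 3 * n * (\<alpha> + 2 * \<delta>) / s"
      unfolding \<kappa> .
    have "v3 - (K * l * (\<tau> + \<alpha> * n * l) * v1 + \<alpha> * \<kappa> * l\<^sup>2 * n * v2 + (\<sigma> + \<alpha> * K * l) * v3)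
        = D - q * \<delta>"
      unfolding eq using pos
      by (simp add: v1_def v3_def D_def q_def field_simps power2_eq_square power3_eq_cube)
    then show ?thesis using \<delta> by linarith
  qed
  ultimately show thesis by (rule that)
qed

text \<open>Positivity of \<open>c d \<epsilon> ytil\<close> is implicit in the step-size condition: if it vanished, the quotient
  would be a division by zero, hence 0, and no positive \<open>\<alpha>\<close> could lie below it.\<close>

lemma tracking_matrix_stable:
  fixes G :: "real ^ 3 ^ 3" and n s l \<alpha> \<sigma> c d \<tau> \<epsilon> ytil \<eta> \<Delta> :: real
  assumes pos: "0 < n" "0 < s" "s \<le> l" "0 \<le> \<tau>" "0 \<le> \<epsilon>" "0 \<le> ytil" "0 < \<sigma>" "\<sigma> < 1" "0 < c" "0 < d"
    and eta: "\<eta> = max \<bar>1 - \<alpha> * n * l\<bar> \<bar>1 - \<alpha> * n * s\<bar>"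
    and G: "G = vector
      [vector [\<sigma>, 0, \<alpha>],
       vector [\<alpha> * c * n * l, \<eta>, 0],
       vector [c * d * \<epsilon> * ytil * l * (\<tau> + \<alpha> * n * l),
               \<alpha> * d * \<epsilon> * l\<^sup>2 * ytil * n,
               \<sigma> + \<alpha> * c * d * \<epsilon> * l * ytil]]"
    and Delta: "\<Delta> = c * d * \<epsilon> * ytil * l * n * s * (\<tau> + 1 - \<sigma>)"
    and alpha: "0 < \<alpha>" "\<alpha> < (sqrt (\<Delta>\<^sup>2 + 4 * c * d * \<epsilon> * ytil * n ^ 3 * l\<^sup>2 * (l + s) * s * (1 - \<sigma>)\<^sup>2) - \<Delta>)
         / (2 * c * d * \<epsilon> * ytil * n\<^sup>2 * l\<^sup>2 * (l + s))" "\<alpha> < 1 / (n * l)"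
  shows "0 \<le> G $ i $ j"
    and "\<exists>r \<Gamma>. 0 < r \<and> r < 1 \<and> 0 < \<Gamma> \<and> (\<forall>k. mat_norm2 (matpow G k) \<le> \<Gamma> * r ^ k)"
proof -
  have l: "0 < l" using pos by linarith
  show nonneg: "0 \<le> G $ i $ j" for i j
    using exhaust_3[of i] exhaust_3[of j] pos l alpha by (auto simp: G eta)
  define K where "K = c * d * \<epsilon> * ytil"
  have "K \<noteq> 0"
  proof
    assume "K = 0"
    then have "2 * c * d * \<epsilon> * ytil * n\<^sup>2 * l\<^sup>2 * (l + s) = 0" by (auto simp: K_def)
    with alpha show False by simp
  qed
  moreover have "0 \<le> K" using pos by (simp add: K_def)
  ultimately have K: "0 < K" by simp
  \<comment> \<open>The bound \<open>1 / (n l)\<close> on the step-size selects the branch of the maximum in \<open>\<eta>\<close>.\<close>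
  have "\<alpha> * n * l < 1" using alpha(3) pos l by (simp add: field_simps)
  moreover have "\<alpha> * n * s \<le> \<alpha> * n * l" using alpha pos by (intro mult_left_mono) auto
  moreover have "0 \<le> \<alpha> * n * s" using alpha pos by simp
  ultimately have \<eta>: "\<eta> = 1 - \<alpha> * n * s" by (simp add: eta)
  have c: "d * \<epsilon> * ytil * c = K" by (simp add: K_def)
  have \<Delta>: "\<Delta> = K * l * n * s * (\<tau> + 1 - \<sigma>)" by (simp add: Delta K_def)
  have \<alpha>: "\<alpha> < (sqrt (\<Delta>\<^sup>2 + 4 * K * n ^ 3 * l\<^sup>2 * (l + s) * s * (1 - \<sigma>)\<^sup>2) - \<Delta>)
         / (2 * K * n\<^sup>2 * l\<^sup>2 * (l + s))"
    using alpha(2) by (simp add: K_def mult.assoc)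
  obtain v1 v2 v3 where v: "0 < v1" "0 < v2" "0 < v3"
    and sub: "\<sigma> * v1 + \<alpha> * v3 < v1"
      "\<alpha> * c * n * l * v1 + (1 - \<alpha> * n * s) * v2 < v2"
      "K * l * (\<tau> + \<alpha> * n * l) * v1 + \<alpha> * (d * \<epsilon> * ytil) * l\<^sup>2 * n * v2 + (\<sigma> + \<alpha> * K * l) * v3 < v3"
    using tracking_matrix_subinvariant[OF K \<open>0 < c\<close> \<open>0 < n\<close> l \<open>0 < s\<close> \<open>0 < \<alpha>\<close> \<open>0 \<le> \<tau>\<close> \<open>\<sigma> < 1\<close> c \<Delta> \<alpha>]
    by blast
  define v :: "real ^ 3" where "v = vector [v1, v2, v3]"
  have "0 < v $ i" for i using exhaust_3[of i] v by (auto simp: v_def)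
  moreover have "(G *v v) $ i < v $ i" for i
  proof -
    have "(G *v v) $ 1 < v $ 1" "(G *v v) $ 2 < v $ 2"
      using sub(1,2) by (simp_all add: G v_def \<eta> matrix_vector_mult_def sum_3)
    moreover have "(G *v v) $ 3 < v $ 3"
      using sub(3) by (simp add: G v_def K_def matrix_vector_mult_def sum_3 mult_ac)
    ultimately show ?thesis using exhaust_3[of i] by auto
  qed
  ultimately show "\<exists>r \<Gamma>. 0 < r \<and> r < 1 \<and> 0 < \<Gamma> \<and> (\<forall>k. mat_norm2 (matpow G k) \<le> \<Gamma> * r ^ k)"
    by (rule matpow_geometric_if_strictly_subinvariant[OF nonneg])
qed

section \<open>The three coupled errors\<close>

text \<open>The iteration seen through what the convergence proof needs of it. The matrices \<open>W k\<close> stand for the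
  inverse diagonals; they enter only through a uniform bound, geometrically small increments, and
  the limit of \<open>Yinf W k\<close>.\<close>

locale gradient_tracking =
  fixes A Yinf :: "real ^ 'n ^ 'n" and p :: "real ^ 'n" and W :: "nat \<Rightarrow> real ^ 'n ^ 'n"
    and f :: "'n \<Rightarrow> real \<Rightarrow> real" and N :: "real ^ 'n \<Rightarrow> real" and x z :: "nat \<Rightarrow> real ^ 'n"
    and n s l \<alpha> \<sigma> c d ytil xstar C \<gamma> :: real
  assumes n: "n = real CARD('n)"
    and Yinf_entry: "\<And>i j. Yinf $ i $ j = p $ j"
    and Yinf_A: "Yinf ** A = Yinf" and A_vec: "\<And>a. A *v vec a = vec a"
    and W_0: "W 0 = mat 1"
    and W_bound: "\<And>k v. norm (W k *v v) \<le> ytil * norm v"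
    and W_step: "\<And>k v. norm (W (Suc k) *v v - W k *v v) \<le> C * \<gamma> ^ k * norm v"
    and W_limit: "\<And>k v. norm (Yinf *v (W k *v v) - vec (\<Sum>i\<in>UNIV. v $ i)) \<le> C * \<gamma> ^ k * norm v"
    and C: "0 \<le> C" and \<gamma>: "0 < \<gamma>"
    and x_Suc: "\<And>k. x (Suc k) = A *v x k - \<alpha> *\<^sub>R z k"
    and z_0: "z 0 = grad_vec f (x 0)"
    and z_Suc: "\<And>k. z (Suc k)
      = A *v z k + W (Suc k) *v grad_vec f (x (Suc k)) - W k *v grad_vec f (x k)"
    and convex: "\<And>i. strongly_convex s (f i)"
    and smooth: "\<And>i. l-lipschitz_on UNIV (deriv (f i))"
    and stationary: "(\<Sum>i\<in>UNIV. deriv (f i) xstar) = 0"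
    and N: "vector_norm N"
    and contraction: "\<And>a. N (A *v a - Yinf *v a) \<le> \<sigma> * N (a - Yinf *v a)"
    and c: "0 < c" "\<And>a. norm a \<le> c * N a" and d: "0 < d" "\<And>a. N a \<le> d * norm a"
    and pos: "0 < \<alpha>" "0 < l" "0 \<le> ytil"
begin

abbreviation g :: "nat \<Rightarrow> real ^ 'n" where "g k \<equiv> grad_vec f (x k)"

definition consensus_err :: "nat \<Rightarrow> real" where
  "consensus_err k = N (x k - Yinf *v x k)"

definition optimality_err :: "nat \<Rightarrow> real" where
  "optimality_err k = norm (Yinf *v x k - vec xstar)"

definition tracking_err :: "nat \<Rightarrow> real" where
  "tracking_err k = N (z k - Yinf *v z k)"

lemma err_nonneg: "0 \<le> consensus_err k" "0 \<le> optimality_err k" "0 \<le> tracking_err k"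
  using N by (auto simp: consensus_err_def optimality_err_def tracking_err_def vector_norm_def)

lemma N_triangle: "N (u + v) \<le> N u + N v"
  using N by (simp add: vector_norm_def)

lemma N_scale: "N (a *\<^sub>R u) = \<bar>a\<bar> * N u"
  using N by (simp add: vector_norm_def)

lemma Yinf_mult: "Yinf *v v = vec (p \<bullet> v)"
  by (simp add: vec_eq_iff matrix_vector_mult_def Yinf_entry inner_vec_def)

lemma Yinf_A_mult: "Yinf *v (A *v v) = Yinf *v v"
  by (simp add: matrix_vector_mul_assoc Yinf_A)

text \<open>The tracking invariant: \<open>Yinf\<close> is unchanged by \<open>A\<close>, so the increments added to \<open>z\<close> telescope,
  and \<open>W 0 = mat 1\<close> matches the initial value.\<close>

lemma Yinf_z: "Yinf *v z k = Yinf *v (W k *v g k)"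
proof (induction k)
  case 0
  then show ?case by (simp add: z_0 W_0)
next
  case (Suc k)
  then show ?case
    by (simp add: z_Suc matrix_vector_right_distrib matrix_vector_mult_diff_distrib Yinf_A_mult)
qed

lemma consensus_dist: "norm (x k - Yinf *v x k) \<le> c * consensus_err k"
  unfolding consensus_err_def by (rule c)

lemma dist_minimizer: "norm (x k - vec xstar) \<le> c * consensus_err k + optimality_err k"
  using norm_triangle_ineq[of "x k - Yinf *v x k" "Yinf *v x k - vec xstar"] consensus_dist[of k]
  by (simp add: optimality_err_def)

lemma norm_grad_le:
  "norm (g k) \<le> norm (grad_vec f (vec xstar)) + l * (c * consensus_err k + optimality_err k)"
proof -
  have "norm (g k) \<le> norm (grad_vec f (vec xstar)) + norm (g k - grad_vec f (vec xstar))"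
    by (metis add.commute diff_add_cancel norm_triangle_ineq)
  also have "norm (g k - grad_vec f (vec xstar)) \<le> l * norm (x k - vec xstar)"
    by (rule norm_grad_vec_diff_le[OF smooth])
  also have "\<dots> \<le> l * (c * consensus_err k + optimality_err k)"
    using pos by (intro mult_left_mono dist_minimizer) simp
  finally show ?thesis by simp
qed

lemma norm_total_grad_diff_le:
  "norm (vec (\<Sum>i\<in>UNIV. grad_vec f u $ i) - vec (\<Sum>i\<in>UNIV. grad_vec f v $ i) :: real ^ 'n)
    \<le> n * l * norm (u - v)"
proof -
  have "vec (\<Sum>i\<in>UNIV. grad_vec f u $ i) - vec (\<Sum>i\<in>UNIV. grad_vec f v $ i)
      = (vec (\<Sum>i\<in>UNIV. (grad_vec f u - grad_vec f v) $ i) :: real ^ 'n)"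
    by (simp add: vec_eq_iff sum_subtractf)
  also have "norm \<dots> \<le> n * norm (grad_vec f u - grad_vec f v)"
    unfolding n by (rule norm_vec_sum_le)
  also have "\<dots> \<le> n * (l * norm (u - v))"
    by (intro mult_left_mono norm_grad_vec_diff_le smooth) (simp add: n)
  finally show ?thesis by simp
qed

lemma total_grad_minimizer: "(\<Sum>i\<in>UNIV. grad_vec f (vec xstar) $ i) = 0"
  using stationary by (simp add: grad_vec_def)

text \<open>The derivative of \<open>\<Sum>\<^sub>i f\<^sub>i\<close> inherits the constants \<open>n s\<close> and \<open>n l\<close>, and on constant vectors the
  Euclidean norm is \<open>sqrt n\<close> times the absolute value, a factor that cancels.\<close>

lemma centralized_step:
  "norm (vec w - \<alpha> *\<^sub>R vec (\<Sum>i\<in>UNIV. grad_vec f (vec w) $ i) - vec xstar :: real ^ 'n)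
    \<le> max \<bar>1 - \<alpha> * n * l\<bar> \<bar>1 - \<alpha> * n * s\<bar> * norm (vec w - vec xstar :: real ^ 'n)"
proof -
  define S where "S u = (\<Sum>i\<in>UNIV. deriv (f i) u)" for u
  have mono: "n * s * (u - v)\<^sup>2 \<le> (S u - S v) * (u - v)" for u v
  proof -
    have "n * s * (u - v)\<^sup>2 = (\<Sum>i\<in>(UNIV :: 'n set). s * (u - v)\<^sup>2)" by (simp add: n)
    also have "\<dots> \<le> (\<Sum>i\<in>UNIV. (deriv (f i) u - deriv (f i) v) * (u - v))"
      by (intro sum_mono strongly_convex_deriv_monotone convex)
    also have "\<dots> = (S u - S v) * (u - v)"
      by (simp add: S_def sum_subtractf sum_distrib_right[symmetric])
    finally show ?thesis .
  qed
  have lip: "\<bar>S u - S v\<bar> \<le> n * l * \<bar>u - v\<bar>" for u v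
  proof -
    have "\<bar>S u - S v\<bar> \<le> (\<Sum>i\<in>UNIV. \<bar>deriv (f i) u - deriv (f i) v\<bar>)"
      by (simp add: S_def sum_subtractf[symmetric])
    also have "\<dots> \<le> (\<Sum>i\<in>(UNIV :: 'n set). l * \<bar>u - v\<bar>)"
      using lipschitz_onD[OF smooth] by (intro sum_mono) (simp add: dist_real_def)
    finally show ?thesis by (simp add: n)
  qed
  have "\<bar>w - \<alpha> * S w - xstar\<bar> \<le> max \<bar>1 - \<alpha> * (n * l)\<bar> \<bar>1 - \<alpha> * (n * s)\<bar> * \<bar>w - xstar\<bar>"
    using mono lip pos stationary by (intro gradient_step_contraction) (auto simp: S_def)
  then have "sqrt n * \<bar>w - \<alpha> * S w - xstar\<bar>
      \<le> sqrt n * (max \<bar>1 - \<alpha> * (n * l)\<bar> \<bar>1 - \<alpha> * (n * s)\<bar> * \<bar>w - xstar\<bar>)"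
    by (intro mult_left_mono) (simp_all add: n)
  moreover have "vec w - \<alpha> *\<^sub>R vec (\<Sum>i\<in>UNIV. grad_vec f (vec w) $ i) - vec xstar
      = (vec (w - \<alpha> * S w - xstar) :: real ^ 'n)"
    "vec w - vec xstar = (vec (w - xstar) :: real ^ 'n)"
    by (simp_all add: vec_eq_iff S_def grad_vec_def)
  ultimately show ?thesis
    by (simp add: norm_vec n mult.assoc mult.left_commute)
qed

text \<open>Since \<open>Yinf A = Yinf\<close>, the deviation of \<open>x\<close> from its average is mapped by \<open>A\<close>, which contracts it
  by \<open>\<sigma>\<close>, and shifted by the deviation of \<open>z\<close> from its own average.\<close>

lemma consensus_err_Suc:
  "consensus_err (Suc k) \<le> \<sigma> * consensus_err k + \<alpha> * tracking_err k"
proof -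
  have "x (Suc k) - Yinf *v x (Suc k)
      = (A *v x k - Yinf *v x k) + (- \<alpha>) *\<^sub>R (z k - Yinf *v z k)"
    by (simp add: x_Suc matrix_vector_mult_diff_distrib Yinf_A_mult matrix_vector_mult_scaleR
        scaleR_diff_right)
  then have "consensus_err (Suc k)
      \<le> N (A *v x k - Yinf *v x k) + \<bar>- \<alpha>\<bar> * N (z k - Yinf *v z k)"
    unfolding consensus_err_def using N_triangle N_scale by metis
  also have "\<dots> \<le> \<sigma> * consensus_err k + \<alpha> * tracking_err k"
    using contraction[of "x k"] pos by (simp add: consensus_err_def tracking_err_def)
  finally show ?thesis .
qed

text \<open>The averaged iterate differs from an exact gradient step on the sum in two ways: the local
  gradients are evaluated at the components of \<open>x k\<close> rather than at their average, which costs the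
  consensus error, and \<open>Yinf W k\<close> only approximates summation.\<close>

lemma optimality_err_Suc:
  "optimality_err (Suc k) \<le> \<alpha> * c * n * l * consensus_err k
    + max \<bar>1 - \<alpha> * n * l\<bar> \<bar>1 - \<alpha> * n * s\<bar> * optimality_err k + \<alpha> * (C * \<gamma> ^ k * norm (g k))"
proof -
  define w where "w = p \<bullet> x k"
  define J :: "real ^ 'n \<Rightarrow> real ^ 'n" where "J v = vec (\<Sum>i\<in>UNIV. v $ i)" for v
  have w: "Yinf *v x k = vec w" by (simp add: w_def Yinf_mult)
  have "Yinf *v x (Suc k) = vec w - \<alpha> *\<^sub>R (Yinf *v (W k *v g k))"
    by (simp add: x_Suc matrix_vector_mult_diff_distrib Yinf_A_mult matrix_vector_mult_scaleR
        Yinf_z w)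
  then have step: "Yinf *v x (Suc k) - vec xstar
      = (vec w - \<alpha> *\<^sub>R J (grad_vec f (vec w)) - vec xstar)
        - \<alpha> *\<^sub>R (J (g k) - J (grad_vec f (vec w))) - \<alpha> *\<^sub>R (Yinf *v (W k *v g k) - J (g k))"
    by (simp add: scaleR_diff_right)
  have triangle: "norm (a - b - e) \<le> norm a + norm b + norm e" for a b e :: "real ^ 'n"
    using norm_triangle_ineq4[of "a - b" e] norm_triangle_ineq4[of a b] by linarith
  have "optimality_err (Suc k)
      \<le> norm (vec w - \<alpha> *\<^sub>R J (grad_vec f (vec w)) - vec xstar)
        + norm (\<alpha> *\<^sub>R (J (g k) - J (grad_vec f (vec w))))
        + norm (\<alpha> *\<^sub>R (Yinf *v (W k *v g k) - J (g k)))"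
    unfolding optimality_err_def step by (rule triangle)
  also have "norm (vec w - \<alpha> *\<^sub>R J (grad_vec f (vec w)) - vec xstar)
      \<le> max \<bar>1 - \<alpha> * n * l\<bar> \<bar>1 - \<alpha> * n * s\<bar> * optimality_err k"
    unfolding optimality_err_def w J_def by (rule centralized_step)
  also have "norm (\<alpha> *\<^sub>R (J (g k) - J (grad_vec f (vec w)))) \<le> \<alpha> * (n * l * (c * consensus_err k))"
  proof -
    have "norm (J (g k) - J (grad_vec f (vec w))) \<le> n * l * norm (x k - vec w)"
      unfolding J_def by (rule norm_total_grad_diff_le)
    also have "\<dots> \<le> n * l * (c * consensus_err k)"
      using consensus_dist[of k] pos by (intro mult_left_mono) (auto simp: w n)
    finally show ?thesis using pos by (simp add: mult_left_mono)
  qed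
  also have "norm (\<alpha> *\<^sub>R (Yinf *v (W k *v g k) - J (g k))) \<le> \<alpha> * (C * \<gamma> ^ k * norm (g k))"
    using W_limit[of k "g k"] pos by (simp add: J_def)
  finally show ?thesis by (simp add: mult_ac)
qed

text \<open>The average of \<open>z k\<close> approximates the total gradient, which is Lipschitz and vanishes at the
  minimizer; this is why \<open>z k\<close> is controlled by the errors up to a decaying term.\<close>

lemma norm_z_le:
  "norm (z k) \<le> c * tracking_err k + n * l * (c * consensus_err k + optimality_err k)
    + C * \<gamma> ^ k * norm (g k)"
proof -
  define J :: "real ^ 'n \<Rightarrow> real ^ 'n" where "J v = vec (\<Sum>i\<in>UNIV. v $ i)" for v
  have J0: "J (grad_vec f (vec xstar)) = 0"
    unfolding J_def total_grad_minimizer by (simp add: vec_eq_iff)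
  have triangle: "norm (a + b + e) \<le> norm a + norm b + norm e" for a b e :: "real ^ 'n"
    using norm_triangle_ineq[of "a + b" e] norm_triangle_ineq[of a b] by linarith
  have "z k = (z k - Yinf *v z k) + (J (g k) - J (grad_vec f (vec xstar)))
      + (Yinf *v (W k *v g k) - J (g k))"
    by (simp add: Yinf_z J0)
  then have "norm (z k) \<le> norm (z k - Yinf *v z k) + norm (J (g k) - J (grad_vec f (vec xstar)))
      + norm (Yinf *v (W k *v g k) - J (g k))"
    using triangle by metis
  also have "norm (z k - Yinf *v z k) \<le> c * tracking_err k"
    unfolding tracking_err_def by (rule c)
  also have "norm (J (g k) - J (grad_vec f (vec xstar))) \<le> n * l * norm (x k - vec xstar)"
    unfolding J_def by (rule norm_total_grad_diff_le)
  also have "\<dots> \<le> n * l * (c * consensus_err k + optimality_err k)"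
    using pos by (intro mult_left_mono dist_minimizer) (auto simp: n)
  also have "norm (Yinf *v (W k *v g k) - J (g k)) \<le> C * \<gamma> ^ k * norm (g k)"
    unfolding J_def by (rule W_limit)
  finally show ?thesis by simp
qed

lemma norm_x_step_le:
  "norm (x (Suc k) - x k) \<le> mat_norm2 (A - mat 1) * (c * consensus_err k) + \<alpha> * norm (z k)"
proof -
  have "A *v (Yinf *v x k) = Yinf *v x k" by (simp add: Yinf_mult A_vec)
  then have "x (Suc k) - x k = (A - mat 1) *v (x k - Yinf *v x k) - \<alpha> *\<^sub>R z k"
    by (simp add: x_Suc matrix_vector_mult_diff_distrib matrix_vector_mult_diff_rdistrib)
  then have "norm (x (Suc k) - x k)
      \<le> norm ((A - mat 1) *v (x k - Yinf *v x k)) + norm (\<alpha> *\<^sub>R z k)"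
    by (metis norm_triangle_ineq4)
  also have "norm ((A - mat 1) *v (x k - Yinf *v x k))
      \<le> mat_norm2 (A - mat 1) * norm (x k - Yinf *v x k)"
    by (rule norm_mult_le_mat_norm2)
  also have "\<dots> \<le> mat_norm2 (A - mat 1) * (c * consensus_err k)"
    by (intro mult_left_mono consensus_dist mat_norm2_nonneg)
  finally show ?thesis using pos by simp
qed

text \<open>The new information \<open>q\<close> in \<open>z\<close> is a change of gradients, hence bounded by a change of \<open>x\<close>, plus a
  change of \<open>W\<close>. The step of \<open>x\<close> is in turn a sum of a consensus correction and of \<open>\<alpha> z k\<close>, which
  feeds all three errors back.\<close>

lemma tracking_err_Suc:
  fixes \<epsilon> \<tau>
  defines "\<epsilon> \<equiv> mat_norm2 (mat 1 - Yinf)" and "\<tau> \<equiv> mat_norm2 (A - mat 1)"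
  shows "tracking_err (Suc k) \<le> c * d * \<epsilon> * ytil * l * (\<tau> + \<alpha> * n * l) * consensus_err k
    + \<alpha> * d * \<epsilon> * l\<^sup>2 * ytil * n * optimality_err k
    + (\<sigma> + \<alpha> * c * d * \<epsilon> * l * ytil) * tracking_err k
    + d * \<epsilon> * (ytil * l * \<alpha> + 1) * (C * \<gamma> ^ k * norm (g k))"
proof -
  define q where "q = W (Suc k) *v g (Suc k) - W k *v g k"
  define h where "h = C * \<gamma> ^ k * norm (g k)"
  have \<epsilon>: "0 \<le> \<epsilon>" unfolding \<epsilon>_def by (rule mat_norm2_nonneg)
  have "norm q \<le> ytil * (l * (\<tau> * (c * consensus_err k) + \<alpha> * norm (z k))) + h"
  proof -
    have "q = W (Suc k) *v (g (Suc k) - g k) + (W (Suc k) *v g k - W k *v g k)"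
      by (simp add: q_def matrix_vector_mult_diff_distrib)
    then have "norm q \<le> norm (W (Suc k) *v (g (Suc k) - g k)) + norm (W (Suc k) *v g k - W k *v g k)"
      by (metis norm_triangle_ineq)
    also have "norm (W (Suc k) *v (g (Suc k) - g k)) \<le> ytil * norm (g (Suc k) - g k)"
      by (rule W_bound)
    also have "\<dots> \<le> ytil * (l * norm (x (Suc k) - x k))"
      by (intro mult_left_mono norm_grad_vec_diff_le smooth pos)
    also have "\<dots> \<le> ytil * (l * (\<tau> * (c * consensus_err k) + \<alpha> * norm (z k)))"
      unfolding \<tau>_def using pos by (intro mult_left_mono norm_x_step_le) auto
    also have "norm (W (Suc k) *v g k - W k *v g k) \<le> h"
      unfolding h_def by (rule W_step)
    finally show ?thesis by simp
  qed
  also have "\<dots> \<le> ytil * (l * (\<tau> * (c * consensus_err k) + \<alpha> * (c * tracking_err k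
      + n * l * (c * consensus_err k + optimality_err k) + h))) + h"
    unfolding h_def using pos by (intro add_mono mult_left_mono norm_z_le order_refl) auto
  finally have q: "norm q \<le> \<dots>" .
  have "z (Suc k) - Yinf *v z (Suc k) = (A *v z k - Yinf *v z k) + (mat 1 - Yinf) *v q"
    by (simp add: z_Suc q_def matrix_vector_right_distrib matrix_vector_mult_diff_distrib
        matrix_vector_mult_diff_rdistrib Yinf_A_mult)
  then have "tracking_err (Suc k) \<le> N (A *v z k - Yinf *v z k) + N ((mat 1 - Yinf) *v q)"
    unfolding tracking_err_def by (metis N_triangle)
  also have "\<dots> \<le> \<sigma> * tracking_err k + d * (\<epsilon> * norm q)"
  proof (rule add_mono)
    show "N (A *v z k - Yinf *v z k) \<le> \<sigma> * tracking_err k"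
      unfolding tracking_err_def by (rule contraction)
    have "N ((mat 1 - Yinf) *v q) \<le> d * norm ((mat 1 - Yinf) *v q)" by (rule d)
    also have "\<dots> \<le> d * (\<epsilon> * norm q)"
      unfolding \<epsilon>_def using d by (intro mult_left_mono norm_mult_le_mat_norm2) simp
    finally show "N ((mat 1 - Yinf) *v q) \<le> d * (\<epsilon> * norm q)" .
  qed
  also have "\<dots> \<le> \<sigma> * tracking_err k + d * (\<epsilon> * (ytil * (l * (\<tau> * (c * consensus_err k)
      + \<alpha> * (c * tracking_err k + n * l * (c * consensus_err k + optimality_err k) + h))) + h))"
    using d \<epsilon> by (intro add_left_mono mult_left_mono q) auto
  also have "\<dots> = c * d * \<epsilon> * ytil * l * (\<tau> + \<alpha> * n * l) * consensus_err k
    + \<alpha> * d * \<epsilon> * l\<^sup>2 * ytil * n * optimality_err k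
    + (\<sigma> + \<alpha> * c * d * \<epsilon> * l * ytil) * tracking_err k
    + d * \<epsilon> * (ytil * l * \<alpha> + 1) * h"
    by (simp add: algebra_simps power2_eq_square)
  finally show ?thesis unfolding h_def .
qed

definition err :: "nat \<Rightarrow> real ^ 3" where
  "err k = vector [consensus_err k, optimality_err k, tracking_err k]"

lemma err_nth [simp]: "err k $ 1 = consensus_err k" "err k $ 2 = optimality_err k" "err k $ 3 = tracking_err k"
  by (simp_all add: err_def)

lemma err_comp_nonneg: "0 \<le> err k $ i"
  using err_nonneg exhaust_3[of i] by auto

lemma dist_minimizer_le_err: "norm (x k - vec xstar) \<le> (c + 1) * norm (err k)"
proof -
  have "norm (x k - vec xstar) \<le> c * consensus_err k + optimality_err k" by (rule dist_minimizer)
  also have "\<dots> \<le> c * norm (err k) + norm (err k)"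
    using c component_le_norm_cart[of "err k" 1] component_le_norm_cart[of "err k" 2]
      err_nonneg[of k] by (intro add_mono mult_left_mono) auto
  finally show ?thesis by (simp add: algebra_simps)
qed

text \<open>The perturbations in the last two of the three estimates are multiples of the norm of the gradients, which grows
  at most linearly with the errors; hence the factor \<open>1 + norm (err k)\<close>.\<close>

lemma err_recursion:
  fixes \<epsilon> \<tau> G
  defines "\<epsilon> \<equiv> mat_norm2 (mat 1 - Yinf)" and "\<tau> \<equiv> mat_norm2 (A - mat 1)"
  assumes G: "G = vector
      [vector [\<sigma>, 0, \<alpha>],
       vector [\<alpha> * c * n * l, max \<bar>1 - \<alpha> * n * l\<bar> \<bar>1 - \<alpha> * n * s\<bar>, 0],
       vector [c * d * \<epsilon> * ytil * l * (\<tau> + \<alpha> * n * l),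
               \<alpha> * d * \<epsilon> * l\<^sup>2 * ytil * n,
               \<sigma> + \<alpha> * c * d * \<epsilon> * l * ytil]]"
  shows "\<exists>C'\<ge>0. \<forall>k i. err (Suc k) $ i \<le> (G *v err k) $ i + C' * \<gamma> ^ k * (1 + norm (err k))"
proof -
  define H where "H = norm (grad_vec f (vec xstar)) + l * (c + 1)"
  define b where "b = \<alpha> + d * \<epsilon> * (ytil * l * \<alpha> + 1)"
  have H: "0 \<le> H" using pos c by (simp add: H_def)
  have \<epsilon>: "0 \<le> \<epsilon>" unfolding \<epsilon>_def by (rule mat_norm2_nonneg)
  have nonneg: "0 \<le> d * \<epsilon> * (ytil * l * \<alpha> + 1)" using d \<epsilon> pos by simp
  then have b: "0 \<le> b" using pos by (simp add: b_def)
  have grad: "norm (g k) \<le> H * (1 + norm (err k))" for k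
  proof -
    have "c * consensus_err k + optimality_err k \<le> c * norm (err k) + norm (err k)"
      using c component_le_norm_cart[of "err k" 1] component_le_norm_cart[of "err k" 2]
        err_nonneg[of k] by (intro add_mono mult_left_mono) auto
    then have "l * (c * consensus_err k + optimality_err k) \<le> l * (c * norm (err k) + norm (err k))"
      using pos by (intro mult_left_mono) auto
    with norm_grad_le[of k]
    have "norm (g k) \<le> norm (grad_vec f (vec xstar)) + l * (c + 1) * norm (err k)"
      by (simp add: algebra_simps)
    also have "\<dots> \<le> H * (1 + norm (err k))"
      using pos c by (simp add: H_def algebra_simps)
    finally show ?thesis .
  qed
  have pert: "a * (C * \<gamma> ^ k * norm (g k)) \<le> b * C * H * \<gamma> ^ k * (1 + norm (err k))"
    if "0 \<le> a" "a \<le> b" for a k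
  proof -
    have "a * (C * \<gamma> ^ k * norm (g k)) \<le> b * (C * \<gamma> ^ k * (H * (1 + norm (err k))))"
      using that b C \<gamma> grad[of k] by (intro mult_mono) auto
    then show ?thesis by (simp add: mult_ac)
  qed
  have "err (Suc k) $ i \<le> (G *v err k) $ i + b * C * H * \<gamma> ^ k * (1 + norm (err k))" for k i
  proof -
    have "0 \<le> b * C * H * \<gamma> ^ k * (1 + norm (err k))"
      using b C H \<gamma> by (intro mult_nonneg_nonneg add_nonneg_nonneg) auto
    then have "err (Suc k) $ 1 \<le> (G *v err k) $ 1 + b * C * H * \<gamma> ^ k * (1 + norm (err k))"
      using consensus_err_Suc[of k] by (simp add: G matrix_vector_mult_def sum_3)
    moreover have "err (Suc k) $ 2 \<le> (G *v err k) $ 2 + b * C * H * \<gamma> ^ k * (1 + norm (err k))"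
      using optimality_err_Suc[of k] pert[of \<alpha> k] pos nonneg
      by (simp add: G matrix_vector_mult_def sum_3 b_def)
    moreover have "err (Suc k) $ 3 \<le> (G *v err k) $ 3 + b * C * H * \<gamma> ^ k * (1 + norm (err k))"
      using tracking_err_Suc[of k] pert[of "d * \<epsilon> * (ytil * l * \<alpha> + 1)" k] pos nonneg
      by (simp add: G matrix_vector_mult_def sum_3 b_def \<epsilon>_def \<tau>_def)
    ultimately show ?thesis using exhaust_3[of i] by auto
  qed
  moreover have "0 \<le> b * C * H" using b C H by simp
  ultimately show ?thesis by blast
qed

end

section \<open>Linear convergence\<close>

theorem theorem2:
  fixes E :: "('n::finite \<times> 'n) set"
    and A Yinf :: "real ^ 'n ^ 'n"
    and f :: "'n \<Rightarrow> real \<Rightarrow> real"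
    and N :: "real ^ 'n \<Rightarrow> real"
    and x z :: "nat \<Rightarrow> real ^ 'n"
    and Y :: "nat \<Rightarrow> real ^ 'n ^ 'n"
    and G :: "real ^ 3 ^ 3"
    and n s l \<alpha> \<sigma> c d \<tau> \<epsilon> ytil \<eta> \<gamma>1 T \<Delta> alphabar xstar :: real
  assumes n: "n = real CARD('n)" "CARD('n) \<ge> 2"
    and graph: "strongly_connected E"
    and weights: "row_stochastic_weights E A"
    and s: "s > 0" and l: "l > 0"
    and diff: "\<And>i t. f i differentiable (at t)"
    and sconv: "\<And>i. strongly_convex s (f i)"
    and lips: "\<And>i. l-lipschitz_on UNIV (deriv (f i))"
    and xstar: "is_arg_min (\<lambda>t. \<Sum>i\<in>UNIV. f i t) (\<lambda>_. True) xstar"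
    and Yinf: "Yinf = lim (\<lambda>k. matpow A k)"
    and tau: "\<tau> = mat_norm2 (A - mat 1)"
    and epsilon: "\<epsilon> = mat_norm2 (mat 1 - Yinf)"
    and ytil: "ytil = (SUP k. mat_norm2 (matrix_inv (diag_part (matpow A k))))"
    and gamma1: "0 < \<gamma>1" "\<gamma>1 < 1" "0 < T"
      "\<And>k. mat_norm2 (matpow A k - Yinf) \<le> T * \<gamma>1 ^ k"
    and N: "vector_norm N"
    and sigma: "0 < \<sigma>" "\<sigma> < 1"
      "\<And>a. N (A *v a - Yinf *v a) \<le> \<sigma> * N (a - Yinf *v a)"
    and c: "c > 0" "\<And>a. norm a \<le> c * N a"
    and d: "d > 0" "\<And>a. N a \<le> d * norm a"
    and eta: "\<eta> = max \<bar>1 - \<alpha> * n * l\<bar> \<bar>1 - \<alpha> * n * s\<bar>"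
    and G: "G = vector
      [vector [\<sigma>, 0, \<alpha>],
       vector [\<alpha> * c * n * l, \<eta>, 0],
       vector [c * d * \<epsilon> * ytil * l * (\<tau> + \<alpha> * n * l),
               \<alpha> * d * \<epsilon> * l\<^sup>2 * ytil * n,
               \<sigma> + \<alpha> * c * d * \<epsilon> * l * ytil]]"
    and Delta: "\<Delta> = c * d * \<epsilon> * ytil * l * n * s * (\<tau> + 1 - \<sigma>)"
    and alphabar: "alphabar = min
      ((sqrt (\<Delta>\<^sup>2 + 4 * c * d * \<epsilon> * ytil * n ^ 3 * l\<^sup>2 * (l + s) * s * (1 - \<sigma>)\<^sup>2) - \<Delta>)
         / (2 * c * d * \<epsilon> * ytil * n\<^sup>2 * l\<^sup>2 * (l + s)))
      (1 / (n * l))"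
    and alpha: "0 < \<alpha>" "\<alpha> < alphabar"
    and iterates: "algorithm_iterates A \<alpha> f x Y z"
  shows "(\<exists>\<gamma>2 \<Gamma>2. 0 < \<gamma>2 \<and> \<gamma>2 < 1 \<and> 0 < \<Gamma>2 \<and> (\<forall>k. mat_norm2 (matpow G k) \<le> \<Gamma>2 * \<gamma>2 ^ k))
    \<and> (\<forall>\<gamma>2 \<Gamma>2. 0 < \<gamma>2 \<and> \<gamma>2 < 1 \<and> 0 < \<Gamma>2 \<and> (\<forall>k. mat_norm2 (matpow G k) \<le> \<Gamma>2 * \<gamma>2 ^ k)
         \<longrightarrow> (let \<gamma> = max \<gamma>1 \<gamma>2 in
               \<gamma> < 1 \<and>
               (\<forall>\<xi>>0. \<exists>M>0. \<forall>k. norm (x k - (\<chi> i. xstar)) \<le> M * (\<gamma> + \<xi>) ^ k)))"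
proof -
  have n_pos: "0 < n" using n by simp
  have s_le_l: "s \<le> l" by (rule strongly_convex_le_lipschitz[OF sconv lips])
  have Y: "Y k = matpow A k" for k
    using iterates by (induction k) (simp_all add: algorithm_iterates_def)
  obtain p C where rows: "\<And>i j. Yinf $ i $ j = p $ j"
    and Yinf_A: "Yinf ** A = Yinf"
    and bdd: "bdd_above (range (\<lambda>k. mat_norm2 (matrix_inv (diag_part (matpow A k)))))" and C: "0 \<le> C"
    and step: "\<And>k v. norm (matrix_inv (diag_part (matpow A (Suc k))) *v v
      - matrix_inv (diag_part (matpow A k)) *v v) \<le> C * \<gamma>1 ^ k * norm v"
    and limit: "\<And>k v. norm (Yinf *v (matrix_inv (diag_part (matpow A k)) *v v)
      - vec (\<Sum>i\<in>UNIV. v $ i)) \<le> C * \<gamma>1 ^ k * norm v"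
    by (rule diag_inverse_weights[OF graph weights gamma1]) (rule that)
  have ytil_upper: "mat_norm2 (matrix_inv (diag_part (matpow A k))) \<le> ytil" for k
    unfolding ytil using bdd by (intro cSUP_upper) auto
  then have ytil_nonneg: "0 \<le> ytil" using mat_norm2_nonneg order_trans by blast
  have \<epsilon>\<tau>: "0 \<le> \<epsilon>" "0 \<le> \<tau>" unfolding epsilon tau by (rule mat_norm2_nonneg)+
  note G_stable = tracking_matrix_stable[OF n_pos s s_le_l \<epsilon>\<tau>(2) \<epsilon>\<tau>(1) ytil_nonneg sigma(1,2) c(1) d(1) eta G Delta alpha(1)]
  have \<alpha>: "\<alpha> < (sqrt (\<Delta>\<^sup>2 + 4 * c * d * \<epsilon> * ytil * n ^ 3 * l\<^sup>2 * (l + s) * s * (1 - \<sigma>)\<^sup>2) - \<Delta>)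
         / (2 * c * d * \<epsilon> * ytil * n\<^sup>2 * l\<^sup>2 * (l + s))" "\<alpha> < 1 / (n * l)"
    using alpha(2) unfolding alphabar by simp_all
  interpret gradient_tracking A Yinf p "\<lambda>k. matrix_inv (diag_part (Y k))" f N x z n s l \<alpha> \<sigma> c d ytil xstar C \<gamma>1
  proof
    show "n = real CARD('n)" by (rule n)
    show "Yinf $ i $ j = p $ j" for i j by (rule rows)
    show "Yinf ** A = Yinf" by (rule Yinf_A)
    show "A *v vec a = vec a" for a by (rule row_stochastic_mult_vec[OF weights])
    have "diag_part (mat 1 :: real ^ 'n ^ 'n) = mat 1"
      by (simp add: diag_part_def mat_def vec_eq_iff)
    then show "matrix_inv (diag_part (Y 0)) = mat 1"
      by (simp add: Y matrix_inv_eqI)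
    show "norm (matrix_inv (diag_part (Y k)) *v v) \<le> ytil * norm v" for k v
      unfolding Y by (rule order_trans[OF norm_mult_le_mat_norm2 mult_right_mono[OF ytil_upper]]) simp
    show "norm (matrix_inv (diag_part (Y (Suc k))) *v v - matrix_inv (diag_part (Y k)) *v v)
        \<le> C * \<gamma>1 ^ k * norm v" for k v
      unfolding Y by (rule step)
    show "norm (Yinf *v (matrix_inv (diag_part (Y k)) *v v) - vec (\<Sum>i\<in>UNIV. v $ i))
        \<le> C * \<gamma>1 ^ k * norm v" for k v
      unfolding Y by (rule limit)
    show "(\<Sum>i\<in>UNIV. deriv (f i) xstar) = 0" by (rule sum_deriv_at_minimizer[OF diff xstar])
  qed (use C gamma1 iterates sconv lips N sigma c d alpha l ytil_nonneg in
      \<open>auto simp: algorithm_iterates_def\<close>)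
  obtain C' where C': "0 \<le> C'"
    and rec: "\<And>k i. err (Suc k) $ i \<le> (G *v err k) $ i + C' * \<gamma>1 ^ k * (1 + norm (err k))"
    using err_recursion[OF G[unfolded eta epsilon tau]] by blast
  have rate: "\<exists>M>0. \<forall>k. norm (x k - (\<chi> i. xstar)) \<le> M * (max \<gamma>1 \<gamma>2 + \<xi>) ^ k"
    if pow: "\<And>k. mat_norm2 (matpow G k) \<le> \<Gamma> * \<gamma>2 ^ k" and "0 < \<gamma>2" "0 < \<xi>" for \<gamma>2 \<Gamma> \<xi>
  proof -
    obtain M where M: "0 < M" "\<And>k. norm (err k) \<le> M * (max \<gamma>1 \<gamma>2 + \<xi>) ^ k"
      using perturbed_linear_recursion[OF G_stable(1)[OF \<alpha>] err_comp_nonneg rec pow gamma1(1,2) \<open>0 < \<gamma>2\<close> C' \<open>0 < \<xi>\<close>]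
      by blast
    have "norm (x k - (\<chi> i. xstar)) \<le> ((c + 1) * M) * (max \<gamma>1 \<gamma>2 + \<xi>) ^ k" for k
    proof -
      have "norm (x k - (\<chi> i. xstar)) \<le> (c + 1) * norm (err k)"
        using dist_minimizer_le_err[of k] by (simp add: vec_def)
      also have "\<dots> \<le> (c + 1) * (M * (max \<gamma>1 \<gamma>2 + \<xi>) ^ k)"
        using c M by (intro mult_left_mono) auto
      finally show ?thesis by (simp add: mult.assoc)
    qed
    moreover have "0 < (c + 1) * M" using c M by simp
    ultimately show ?thesis by blast
  qed
  show ?thesis
    unfolding Let_def using G_stable(2)[OF \<alpha>] rate gamma1(2) by auto
qed

end
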